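(* Let $S_n$ be the symmetric group on $X=\{1,\ldots,n\}$, and let $W(\Phi)$ denote the Weyl group of the root system $\Phi$. Then: (1) for $n\ge 2$, $$\frac{2^{\star \binom{n}{1}}:S_n}{(t_1(1\,2))^3}\cong W(A_n),$$ where $S_n$ acts on the symmetric generators $t_i$ ($i\in X$) as it acts naturally on $X$; (2) for $n\ge 4$, $$\frac{2^{\star \binom{n}{2}}:S_n}{(t_{12}(2\,3))^3}\cong W(D_n),$$ where $S_n$ acts on the symmetric generators $t_{ij}=t_{\{i,j\}}$ as it acts on the 2-element subsets of $X$; (3) for $n=6,7,8$, $$\frac{2^{\star \binom{n}{3}}:S_n}{(t_{123}(3\,4))^3}\cong W(E_n),$$ where $S_n$ acts on the symmetric generators $t_{ijk}=t_{\{i,j,k\}}$ as it acts on the 3-element subsets of $X$.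
   Context: For $k\ge 1$, $2^{\star\binom{n}{k}}$ denotes the free product of $\binom{n}{k}$ cyclic groups of order 2, with involutory generators $t_A$ indexed by the $k$-element subsets $A$ of $X=\{1,\ldots,n\}$ (called symmetric generators; for example $t_1=t_{\{1\}}$, $t_{12}=t_{\{1,2\}}$, $t_{123}=t_{\{1,2,3\}}$). Each $\pi\in S_n$ induces an automorphism of this free product permuting the generators by $t_A\mapsto t_{\pi(A)}$, and $2^{\star\binom{n}{k}}:S_n$ is the resulting semidirect product, in which $\pi^{-1}t_A\pi=t_{\pi(A)}$ for $\pi\in S_n$ (permutations are composed from left to right). For an element $r$ of this group, $\dfrac{2^{\star\binom{n}{k}}:S_n}{r}$ denotes its quotient by the normal closure of $r$. *)

theory Defs
  imports
    "HOL-Algebra.Bij"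
    "HOL-Algebra.Generated_Groups"
    "HOL-Algebra.Elementary_Groups"
    "HOL-Combinatorics.Permutations"
    "Jordan_Normal_Form.Matrix"
begin

section \<open>Free products\<close>

text \<open>Elements are the reduced words: lists of non-identity elements of the factors, tagged with
  the index of their factor, in which no two neighbours come from the same factor.\<close>

definition reduced_words :: "'i set \<Rightarrow> ('i \<Rightarrow> ('a, 'm) monoid_scheme) \<Rightarrow> ('i \<times> 'a) list set" where
  "reduced_words I G =
     {w. (\<forall>(i, g) \<in> set w. i \<in> I \<and> g \<in> carrier (G i) \<and> g \<noteq> \<one>\<^bsub>G i\<^esub>) \<and>
         (\<forall>k. Suc k < length w \<longrightarrow> fst (w ! k) \<noteq> fst (w ! Suc k))}"

text \<open>Left multiplication of a reduced word by a single letter:\<close>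

fun letter_mult :: "('i \<Rightarrow> ('a, 'm) monoid_scheme) \<Rightarrow> 'i \<times> 'a \<Rightarrow> ('i \<times> 'a) list \<Rightarrow> ('i \<times> 'a) list" where
  "letter_mult G (i, g) [] = [(i, g)]"
| "letter_mult G (i, g) ((j, h) # w) =
     (if i = j
      then (if g \<otimes>\<^bsub>G i\<^esub> h = \<one>\<^bsub>G i\<^esub> then w else (i, g \<otimes>\<^bsub>G i\<^esub> h) # w)
      else (i, g) # (j, h) # w)"

definition free_product :: "'i set \<Rightarrow> ('i \<Rightarrow> ('a, 'm) monoid_scheme) \<Rightarrow> ('i \<times> 'a) list monoid" where
  "free_product I G =
     \<lparr>carrier = reduced_words I G, monoid.mult = (\<lambda>u v. foldr (letter_mult G) u v), one = []\<rparr>"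

section \<open>Semidirect products\<close>

text \<open>\<open>act\<close> is a right action of \<open>H\<close> on \<open>N\<close> by automorphisms. The pair \<open>(h, a)\<close> stands for the
  product \<open>h a\<close>, and the multiplication encodes \<open>h\<^sup>-\<^sup>1 a h = act h a\<close>, so that
  \<open>(g a) (h b) = (g h) (act h a b)\<close>.\<close>

definition semidirect ::
    "('a, 'm) monoid_scheme \<Rightarrow> ('h, 'k) monoid_scheme \<Rightarrow> ('h \<Rightarrow> 'a \<Rightarrow> 'a) \<Rightarrow> ('h \<times> 'a) monoid" where
  "semidirect N H act =
     \<lparr>carrier = carrier H \<times> carrier N,
      monoid.mult = (\<lambda>(g, a) (h, b). (g \<otimes>\<^bsub>H\<^esub> h, act h a \<otimes>\<^bsub>N\<^esub> b)),
      one = (\<one>\<^bsub>H\<^esub>, \<one>\<^bsub>N\<^esub>)\<rparr>"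

section \<open>Quotient by the normal closure of an element\<close>

definition normal_closure :: "('a, 'm) monoid_scheme \<Rightarrow> 'a set \<Rightarrow> 'a set" where
  "normal_closure G S =
     generate G {x \<otimes>\<^bsub>G\<^esub> s \<otimes>\<^bsub>G\<^esub> inv\<^bsub>G\<^esub> x | x s. x \<in> carrier G \<and> s \<in> S}"

definition quotient_by :: "('a, 'm) monoid_scheme \<Rightarrow> 'a \<Rightarrow> 'a set monoid" where
  "quotient_by G r = G Mod (normal_closure G {r})"

section \<open>The progenitors\<close>

text \<open>Unlike in \<^const>\<open>comp\<close>, permutations are composed from left to right.\<close>

definition sym_group_lr :: "nat \<Rightarrow> (nat \<Rightarrow> nat) monoid" where
  "sym_group_lr n =
     \<lparr>carrier = {p. p permutes {1..n}}, monoid.mult = (\<lambda>p q. q \<circ> p), one = id\<rparr>"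

definition subsets_of_size :: "nat \<Rightarrow> nat \<Rightarrow> nat set set" where
  "subsets_of_size n k = {A. A \<subseteq> {1..n} \<and> card A = k}"

definition involution_product :: "nat \<Rightarrow> nat \<Rightarrow> (nat set \<times> int) list monoid" where
  "involution_product n k = free_product (subsets_of_size n k) (\<lambda>_. integer_mod_group 2)"

definition perm_act :: "(nat \<Rightarrow> nat) \<Rightarrow> (nat set \<times> int) list \<Rightarrow> (nat set \<times> int) list" where
  "perm_act p = map (\<lambda>(A, g). (p ` A, g))"

definition progenitor :: "nat \<Rightarrow> nat \<Rightarrow> ((nat \<Rightarrow> nat) \<times> (nat set \<times> int) list) monoid" where
  "progenitor n k = semidirect (involution_product n k) (sym_group_lr n) perm_act"

definition sym_gen :: "nat set \<Rightarrow> (nat \<Rightarrow> nat) \<times> (nat set \<times> int) list" where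
  "sym_gen A = (id, [(A, 1)])"

definition perm_elt :: "(nat \<Rightarrow> nat) \<Rightarrow> (nat \<Rightarrow> nat) \<times> (nat set \<times> int) list" where
  "perm_elt p = (p, [])"

text \<open>The relator \<open>(t\<^sub>A (a b))\<^sup>3\<close>:\<close>

definition relator :: "nat \<Rightarrow> nat \<Rightarrow> nat set \<Rightarrow> nat \<Rightarrow> nat \<Rightarrow> (nat \<Rightarrow> nat) \<times> (nat set \<times> int) list" where
  "relator n k A a b =
     (sym_gen A \<otimes>\<^bsub>progenitor n k\<^esub> perm_elt (Transposition.transpose a b)) [^]\<^bsub>progenitor n k\<^esub> (3::nat)"

section \<open>Weyl groups\<close>

definition reflection :: "real vec \<Rightarrow> real vec \<Rightarrow> real vec" where
  "reflection \<alpha> v = v - (2 * (v \<bullet> \<alpha>) / (\<alpha> \<bullet> \<alpha>)) \<cdot>\<^sub>v \<alpha>"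

text \<open>The root system \<open>\<Phi>\<close> lies in Euclidean \<open>m\<close>-space and need not span it; the reflections fix the
  orthogonal complement of the span pointwise.\<close>

definition weyl_group :: "nat \<Rightarrow> real vec set \<Rightarrow> (real vec \<Rightarrow> real vec) monoid" where
  "weyl_group m \<Phi> =
     subgroup_generated (BijGroup (carrier_vec m))
       {restrict (reflection \<alpha>) (carrier_vec m) | \<alpha>. \<alpha> \<in> \<Phi>}"

text \<open>The root systems in their usual (Bourbaki) coordinates, indexed from 0.\<close>

definition roots_A :: "nat \<Rightarrow> real vec set" where
  "roots_A n = {unit_vec (n + 1) i - unit_vec (n + 1) j | i j. i < n + 1 \<and> j < n + 1 \<and> i \<noteq> j}"

definition roots_D :: "nat \<Rightarrow> real vec set" where
  "roots_D n =
     {a \<cdot>\<^sub>v unit_vec n i + b \<cdot>\<^sub>v unit_vec n j | a b i j.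
        a \<in> {1, -1} \<and> b \<in> {1, -1} \<and> i < j \<and> j < n}"

definition roots_E8 :: "real vec set" where
  "roots_E8 = roots_D 8 \<union>
     {v \<in> carrier_vec 8. (\<forall>i<8. v $ i \<in> {1/2, -1/2}) \<and> even (card {i. i < 8 \<and> v $ i = -1/2})}"

definition roots_E7 :: "real vec set" where
  "roots_E7 = {v \<in> roots_E8. v $ 6 = - v $ 7}"

definition roots_E6 :: "real vec set" where
  "roots_E6 = {v \<in> roots_E8. v $ 5 = v $ 6 \<and> v $ 6 = - v $ 7}"

text \<open>Intended only for \<open>n \<in> {6, 7, 8}\<close>; all three systems lie in Euclidean 8-space.\<close>

definition roots_E :: "nat \<Rightarrow> real vec set" where
  "roots_E n = (if n = 6 then roots_E6 else if n = 7 then roots_E7 else roots_E8)"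

end

theory Submission
  imports Defs
begin

text \<open>The progenitor is generated by \<open>t_{1..k}\<close> and the adjacent transpositions, and the relator is
  exactly the braid relation that the semidirect product lacks, so in the quotient these generators
  satisfy the Coxeter relations of type A, D or E. The progenitor acts on Euclidean space: \<open>S_n\<close>
  permutes orthonormal vectors, and \<open>t_A\<close> acts as the reflection in a root \<open>\<beta> A\<close>, so that the
  generators become simple reflections. The kernel of the induced action of the quotient is trivial by
  Tits' argument: if the length of \<open>g s\<^sub>i\<close> is not smaller than that of \<open>g\<close>, then \<open>g\<close> maps the simple
  root \<open>\<alpha>\<^sub>i\<close> into the cone spanned by the simple roots. So an element \<open>g \<noteq> 1\<close>, having a descent \<open>s\<^sub>i\<close>,
  maps \<open>\<alpha>\<^sub>i\<close> into the opposite cone. The image is the Weyl group because every root arises from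
  simple roots by adding roots with inner product \<open>-1\<close> and negating.\<close>

section \<open>Free products of groups of order two\<close>

text \<open>One representation serves all three types. The vector \<open>\<delta>\<close> has the
  same inner product \<open>d\<close> with every \<open>f i\<close>, so S_n fixes it, and
  \<open>\<beta> A\<close> is \<open>\<delta>\<close> minus the \<open>f i\<close> with
  \<open>i \<in> A\<close>. Its inner product with a root \<open>f j - f (j + 1)\<close> depends
  only on which of \<open>j\<close>, \<open>j + 1\<close> lie in \<open>A\<close>, not on
  \<open>d\<close>. This alone gives the diagram; norm 2 then ties
  \<open>\<delta> \<bullet> \<delta>\<close> to \<open>d\<close> and \<open>k\<close>. The types
  differ in \<open>k\<close> and in the place of \<open>\<delta>\<close>, chosen to reach the usual
  coordinates. The difficulty is injectivity. The quotient is known only through generators and a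
  relator, with no normal form and no order at hand, so length is taken in the quotient itself and
  positivity of the image of a simple root is made a property of cosets. Two nodes span only A1 x A1
  or A2, so Tits' argument splits off at most two generators at a time.\<close>

abbreviation involution_words :: "'i set \<Rightarrow> ('i \<times> int) list set" where
  "involution_words I \<equiv> reduced_words I (\<lambda>_. integer_mod_group 2)"

abbreviation involution_letter :: "'i \<times> int \<Rightarrow> ('i \<times> int) list \<Rightarrow> ('i \<times> int) list" where
  "involution_letter \<equiv> letter_mult (\<lambda>_. integer_mod_group 2)"

lemma involution_words_Nil [simp]: "[] \<in> involution_words I"
  by (simp add: reduced_words_def)

lemma involution_words_Cons:
  "x # w \<in> involution_words I \<longleftrightarrow>
     fst x \<in> I \<and> snd x = 1 \<and> w \<in> involution_words I \<and> (w \<noteq> [] \<longrightarrow> fst (hd w) \<noteq> fst x)"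
proof -
  have 1: "snd x \<in> {0..<2} \<and> snd x \<noteq> 0 \<longleftrightarrow> snd x = (1::int)"
    by auto
  have 2: "(\<forall>k. Suc k < length (x # w) \<longrightarrow> fst ((x # w) ! k) \<noteq> fst ((x # w) ! Suc k)) \<longleftrightarrow>
      (\<forall>k. Suc k < length w \<longrightarrow> fst (w ! k) \<noteq> fst (w ! Suc k)) \<and> (w \<noteq> [] \<longrightarrow> fst (hd w) \<noteq> fst x)"
    by (cases w) (auto simp: nth_Cons split: nat.splits)
  show ?thesis
    unfolding reduced_words_def mem_Collect_eq 2
    using 1 by (cases x) (auto simp: carrier_integer_mod_group)
qed

text \<open>Each letter is its own inverse, so reversal is inversion of words; this supplies the
  inverses in the free product.\<close>

lemma involution_words_rev:
  assumes "w \<in> involution_words I"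
  shows "rev w \<in> involution_words I"
proof -
  have "fst (rev w ! k) \<noteq> fst (rev w ! Suc k)" if "Suc k < length w" for k
  proof -
    have "Suc (length w - Suc (Suc k)) = length w - Suc k"
      using that by simp
    then have "fst (w ! (length w - Suc (Suc k))) \<noteq> fst (w ! (length w - Suc k))"
      using assms that unfolding reduced_words_def
      by (auto dest: spec[of _ "length w - Suc (Suc k)"])
    then show ?thesis
      using that by (simp add: rev_nth)
  qed
  then show ?thesis
    using assms by (auto simp: reduced_words_def)
qed

lemma involution_letter_eq:
  "involution_letter (i, 1) w = (if w \<noteq> [] \<and> hd w = (i, 1) then tl w else (i, 1) # w)"
  if "w \<in> involution_words I"
  using that by (cases w) (auto simp: involution_words_Cons split: if_splits)

lemma involution_letter_closed:
  assumes "i \<in> I" "w \<in> involution_words I"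
  shows "involution_letter (i, 1) w \<in> involution_words I"
  unfolding involution_letter_eq[OF assms(2)]
  using assms by (cases w) (auto simp: involution_words_Cons)

lemma involution_letter_twice:
  assumes "i \<in> I" "w \<in> involution_words I"
  shows "involution_letter (i, 1) (involution_letter (i, 1) w) = w"
  using assms
  by (cases w) (auto simp: involution_letter_eq[OF assms(2)] involution_letter_eq[where I = I]
      involution_words_Cons split: if_splits intro: prod_eqI)

lemma foldr_involution_letter_closed:
  assumes "u \<in> involution_words I" "v \<in> involution_words I"
  shows "foldr involution_letter u v \<in> involution_words I"
  using assms
proof (induction u)
  case (Cons x u)
  then show ?case
    using involution_letter_closed[of "fst x" I] by (cases x) (auto simp: involution_words_Cons)
qed simp

lemma foldr_involution_letter_assoc:
  assumes "u \<in> involution_words I" "v \<in> involution_words I" "w \<in> involution_words I"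
  shows "foldr involution_letter (foldr involution_letter u v) w =
    foldr involution_letter u (foldr involution_letter v w)"
  using assms(1)
proof (induction u)
  case (Cons x u)
  define y where "y = foldr involution_letter u v"
  have y: "y \<in> involution_words I"
    unfolding y_def using Cons.prems assms
    by (intro foldr_involution_letter_closed) (auto simp: involution_words_Cons)
  obtain i where x: "x = (i, 1)" "i \<in> I"
    using Cons.prems by (cases x) (auto simp: involution_words_Cons)
  have "foldr involution_letter (involution_letter (i, 1) y) w =
      involution_letter (i, 1) (foldr involution_letter y w)"
  proof (cases "y \<noteq> [] \<and> hd y = (i, 1)")
    \<comment> \<open>If the letter cancels the head of \<open>y\<close>, the right-hand side
      applies the same letter twice in a row.\<close>
    case True
    then obtain y' where y': "y = (i, 1) # y'"
      by (cases y) auto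
    then have "foldr involution_letter y' w \<in> involution_words I"
      using y assms by (intro foldr_involution_letter_closed) (auto simp: involution_words_Cons)
    then show ?thesis
      using y' x y by (simp add: involution_letter_twice)
  next
    case False
    then show ?thesis
      by (subst involution_letter_eq[OF y]) auto
  qed
  then show ?case
    using Cons x by (simp add: y_def involution_words_Cons)
qed simp

lemma foldr_involution_letter_rev:
  "u \<in> involution_words I \<Longrightarrow> foldr involution_letter (rev u) u = []"
proof (induction u)
  case (Cons x u)
  then show ?case
    by (cases x) (auto simp: involution_words_Cons)
qed simp

abbreviation involution_free_product :: "'i set \<Rightarrow> ('i \<times> int) list monoid" where
  "involution_free_product I \<equiv> free_product I (\<lambda>_. integer_mod_group 2)"

lemma group_involution_free_product: "group (involution_free_product I)"
proof (rule groupI)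
  fix w assume "w \<in> carrier (involution_free_product I)"
  then show "\<exists>y\<in>carrier (involution_free_product I).
      y \<otimes>\<^bsub>involution_free_product I\<^esub> w = \<one>\<^bsub>involution_free_product I\<^esub>"
    by (intro bexI[of _ "rev w"])
      (auto simp: free_product_def foldr_involution_letter_rev involution_words_rev)
qed (auto simp: free_product_def foldr_involution_letter_closed foldr_involution_letter_assoc)

section \<open>Semidirect products\<close>

lemma group_semidirect:
  assumes N: "group N" and H: "group H"
    and hom: "\<And>h. h \<in> carrier H \<Longrightarrow> act h \<in> hom N N"
    and one: "\<And>a. a \<in> carrier N \<Longrightarrow> act \<one>\<^bsub>H\<^esub> a = a"
    and mult: "\<And>g h a. g \<in> carrier H \<Longrightarrow> h \<in> carrier H \<Longrightarrow> a \<in> carrier N \<Longrightarrow>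
      act (g \<otimes>\<^bsub>H\<^esub> h) a = act h (act g a)"
  shows "group (semidirect N H act)"
proof -
  interpret N: group N by fact
  interpret H: group H by fact
  have closed: "act h a \<in> carrier N" if "h \<in> carrier H" "a \<in> carrier N" for h a
    using hom[OF that(1)] that(2) by (auto simp: hom_def)
  have act_mult: "act h (a \<otimes>\<^bsub>N\<^esub> b) = act h a \<otimes>\<^bsub>N\<^esub> act h b"
    if "h \<in> carrier H" "a \<in> carrier N" "b \<in> carrier N" for h a b
    using hom[OF that(1)] that(2-) by (auto simp: hom_def)
  have act_one: "act h \<one>\<^bsub>N\<^esub> = \<one>\<^bsub>N\<^esub>" if "h \<in> carrier H" for h
    using hom_one[OF hom[OF that]] N by simp
  show ?thesis
  proof (rule groupI)
    fix x assume "x \<in> carrier (semidirect N H act)"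
    then obtain h a where x: "x = (h, a)" "h \<in> carrier H" "a \<in> carrier N"
      by (auto simp: semidirect_def)
    then show "\<exists>y\<in>carrier (semidirect N H act).
        y \<otimes>\<^bsub>semidirect N H act\<^esub> x = \<one>\<^bsub>semidirect N H act\<^esub>"
      \<comment> \<open>The inverse of \<open>h a\<close> is a^-1 h^-1 = h^-1 (h a^-1 h^-1), and
        conjugation in this direction is the action of h^-1.\<close>
      by (intro bexI[of _ "(inv\<^bsub>H\<^esub> h, act (inv\<^bsub>H\<^esub> h) (inv\<^bsub>N\<^esub> a))"])
        (auto simp: semidirect_def closed mult[symmetric] one)
  qed (auto simp: semidirect_def closed act_mult act_one mult one N.m_assoc H.m_assoc)
qed

section \<open>The progenitors\<close>

lemma group_sym_group_lr: "group (sym_group_lr n)"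
proof (rule groupI)
  fix p assume "p \<in> carrier (sym_group_lr n)"
  then show "\<exists>q\<in>carrier (sym_group_lr n). q \<otimes>\<^bsub>sym_group_lr n\<^esub> p = \<one>\<^bsub>sym_group_lr n\<^esub>"
    by (intro bexI[of _ "inv_into UNIV p"])
      (auto simp: sym_group_lr_def permutes_inv permutes_inv_o)
qed (auto simp: sym_group_lr_def permutes_compose permutes_id comp_assoc)

lemma permutes_image_subsets_of_size:
  assumes "p permutes {1..n}" "A \<in> subsets_of_size n k"
  shows "p ` A \<in> subsets_of_size n k"
  using assms permutes_image[OF assms(1)] card_image[OF permutes_inj_on[OF assms(1)]]
  by (auto simp: subsets_of_size_def)

lemma perm_act_letter:
  assumes p: "inj p"
  shows "perm_act p (involution_letter x w) = involution_letter (p ` fst x, snd x) (perm_act p w)"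
  using inj_image_eq_iff[OF p] by (cases x; cases w) (auto simp: perm_act_def)

lemma perm_act_foldr:
  assumes p: "inj p"
  shows "perm_act p (foldr involution_letter u v) = foldr involution_letter (perm_act p u) (perm_act p v)"
proof (induction u)
  case (Cons x u)
  then show ?case
    by (simp add: perm_act_letter[OF p]) (simp add: perm_act_def case_prod_beta)
qed (simp add: perm_act_def)

lemma perm_act_closed:
  assumes p: "p permutes {1..n}" and w: "w \<in> involution_words (subsets_of_size n k)"
  shows "perm_act p w \<in> involution_words (subsets_of_size n k)"
  using w
proof (induction w)
  case (Cons x w)
  have "p ` B = p ` C \<longleftrightarrow> B = C" for B C
    using inj_image_eq_iff[OF permutes_inj[OF p]] by simp
  with Cons show ?case
    by (cases x; cases w)
      (simp_all add: perm_act_def involution_words_Cons permutes_image_subsets_of_size[OF p] case_prod_beta)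
qed (simp add: perm_act_def)

lemma group_progenitor: "group (progenitor n k)"
  unfolding progenitor_def involution_product_def
proof (rule group_semidirect)
  fix p assume "p \<in> carrier (sym_group_lr n)"
  then have p: "p permutes {1..n}"
    by (simp add: sym_group_lr_def)
  show "perm_act p \<in> hom (involution_free_product (subsets_of_size n k))
      (involution_free_product (subsets_of_size n k))"
    using perm_act_closed[OF p] perm_act_foldr[OF permutes_inj[OF p]]
    by (auto simp: hom_def free_product_def)
qed (auto simp: group_involution_free_product group_sym_group_lr,
    auto simp: sym_group_lr_def perm_act_def image_comp intro!: map_idI)

lemma carrier_progenitor:
  "carrier (progenitor n k) = {p. p permutes {1..n}} \<times> involution_words (subsets_of_size n k)"
  by (simp add: progenitor_def semidirect_def sym_group_lr_def involution_product_def free_product_def)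

lemma one_progenitor: "\<one>\<^bsub>progenitor n k\<^esub> = (id, [])"
  by (simp add: progenitor_def semidirect_def sym_group_lr_def involution_product_def free_product_def)

lemma mult_progenitor:
  "(p, u) \<otimes>\<^bsub>progenitor n k\<^esub> (q, v) = (q \<circ> p, foldr involution_letter (perm_act q u) v)"
  by (simp add: progenitor_def semidirect_def sym_group_lr_def involution_product_def free_product_def)

lemma sym_gen_closed:
  "A \<in> subsets_of_size n k \<Longrightarrow> sym_gen A \<in> carrier (progenitor n k)"
  by (simp add: sym_gen_def carrier_progenitor permutes_id involution_words_Cons)

lemma perm_elt_closed: "p permutes {1..n} \<Longrightarrow> perm_elt p \<in> carrier (progenitor n k)"
  by (simp add: perm_elt_def carrier_progenitor)

lemma sym_gen_square: "sym_gen A \<otimes>\<^bsub>progenitor n k\<^esub> sym_gen A = \<one>\<^bsub>progenitor n k\<^esub>"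
  by (simp add: sym_gen_def mult_progenitor one_progenitor perm_act_def)

lemma perm_elt_mult:
  "perm_elt p \<otimes>\<^bsub>progenitor n k\<^esub> perm_elt q = perm_elt (q \<circ> p)"
  by (simp add: perm_elt_def mult_progenitor perm_act_def)

lemma sym_gen_perm_elt:
  "sym_gen A \<otimes>\<^bsub>progenitor n k\<^esub> perm_elt p = perm_elt p \<otimes>\<^bsub>progenitor n k\<^esub> sym_gen (p ` A)"
  by (simp add: sym_gen_def perm_elt_def mult_progenitor perm_act_def)

section \<open>Length in simply laced Coxeter groups\<close>

text \<open>\<open>P i g\<close> abstracts the statement that \<open>g\<close> maps the simple root \<open>\<alpha>\<^sub>i\<close> into the cone of positive
  roots; the conditions relating \<open>P\<close> at \<open>g s\<^sub>j\<close> and at \<open>g s\<^sub>i s\<^sub>j\<close> to \<open>P\<close> at \<open>g\<close> then encode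
  \<open>s\<^sub>j \<alpha>\<^sub>i = \<alpha>\<^sub>i\<close> or \<open>s\<^sub>j \<alpha>\<^sub>i = \<alpha>\<^sub>i + \<alpha>\<^sub>j\<close>.\<close>

locale simply_laced = group G for G (structure) +
  fixes I :: "'i set" and s :: "'i \<Rightarrow> 'a" and P :: "'i \<Rightarrow> 'a \<Rightarrow> bool"
  assumes s_closed [simp]: "i \<in> I \<Longrightarrow> s i \<in> carrier G"
    and s_square: "i \<in> I \<Longrightarrow> s i \<otimes> s i = \<one>"
    and generated: "generate G (s ` I) = carrier G"
    and P_one: "i \<in> I \<Longrightarrow> P i \<one>"
    and relation: "i \<in> I \<Longrightarrow> j \<in> I \<Longrightarrow> i \<noteq> j \<Longrightarrow>
      s i \<otimes> s j = s j \<otimes> s i \<and> (\<forall>g\<in>carrier G. P i g \<longrightarrow> P i (g \<otimes> s j)) \<or>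
      s i \<otimes> s j \<otimes> s i = s j \<otimes> s i \<otimes> s j \<and>
        (\<forall>g\<in>carrier G. (P i g \<and> P j g \<longrightarrow> P i (g \<otimes> s j)) \<and> (P j g \<longrightarrow> P i (g \<otimes> s i \<otimes> s j)))"
begin

inductive word_of_length :: "nat \<Rightarrow> 'a \<Rightarrow> bool" where
  empty: "word_of_length 0 \<one>"
| snoc: "word_of_length n g \<Longrightarrow> i \<in> I \<Longrightarrow> word_of_length (Suc n) (g \<otimes> s i)"

definition len :: "'a \<Rightarrow> nat" where
  "len g = (LEAST n. word_of_length n g)"

lemma word_of_length_closed: "word_of_length n g \<Longrightarrow> g \<in> carrier G"
  by (induction rule: word_of_length.induct) auto

lemma mult_s_s [simp]: "g \<in> carrier G \<Longrightarrow> i \<in> I \<Longrightarrow> g \<otimes> s i \<otimes> s i = g"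
  by (simp add: m_assoc s_square)

lemma ex_word_of_length:
  assumes "g \<in> carrier G"
  shows "\<exists>n. word_of_length n g"
proof -
  have "\<exists>n. word_of_length n (h \<otimes> g)" if "g \<in> generate G (s ` I)" "word_of_length m h" for h m
    using that
  proof (induction arbitrary: h m rule: generate.induct)
    case one
    then show ?case
      using word_of_length_closed by auto
  next
    case (incl g)
    then show ?case
      using word_of_length.snoc by blast
  next
    case (inv g)
    then obtain i where "g = s i" "i \<in> I"
      by blast
    then have "inv g = s i"
      using inv_equality s_square s_closed by blast
    with \<open>g = s i\<close> \<open>i \<in> I\<close> inv show ?case
      using word_of_length.snoc by metis
  next
    case (eng g1 g2)
    have "g1 \<in> carrier G" "g2 \<in> carrier G"
      using eng generated by blast+
    with eng show ?case
      using m_assoc word_of_length_closed by metis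
  qed
  from this[OF _ empty] show ?thesis
    using assms generated by auto
qed

lemma word_of_length_len: "g \<in> carrier G \<Longrightarrow> word_of_length (len g) g"
  unfolding len_def by (rule LeastI_ex) (rule ex_word_of_length)

lemma len_mult_s: "g \<in> carrier G \<Longrightarrow> i \<in> I \<Longrightarrow> len (g \<otimes> s i) \<le> Suc (len g)"
  unfolding len_def[of "g \<otimes> s i"] by (intro Least_le word_of_length.snoc word_of_length_len)

lemma ex_descent:
  assumes "g \<in> carrier G" "g \<noteq> \<one>"
  shows "\<exists>i\<in>I. len (g \<otimes> s i) < len g"
  using word_of_length_len[OF assms(1)]
proof cases
  case (snoc n h i)
  then have "g \<otimes> s i = h"
    using word_of_length_closed by simp
  moreover have "len h \<le> n"
    unfolding len_def by (rule Least_le) (rule snoc)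
  ultimately show ?thesis
    using snoc by (intro bexI[of _ i]) auto
qed (use assms in auto)

text \<open>Induction on the length of \<open>g\<close>: a descent \<open>j\<close> of
  \<open>g\<close> gives a shorter \<open>h\<close> with \<open>g = h s\<^sub>j\<close>, and
  \<open>relation\<close> carries positivity from \<open>h\<close>, or from a still shorter element,
  back to \<open>g\<close>.\<close>

lemma P_if_ascent:
  "g \<in> carrier G \<Longrightarrow> i \<in> I \<Longrightarrow> len g \<le> len (g \<otimes> s i) \<Longrightarrow> P i g"
proof (induction "len g" arbitrary: g i rule: less_induct)
  case less
  note [simp] = \<open>g \<in> carrier G\<close> \<open>i \<in> I\<close>
  show ?case
  proof (cases "g = \<one>")
    case True
    then show ?thesis
      by (simp add: P_one)
  next
    case False
    then obtain j where j [simp]: "j \<in> I" and lt: "len (g \<otimes> s j) < len g"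
      using ex_descent less.prems by blast
    define h where "h = g \<otimes> s j"
    have h [simp]: "h \<in> carrier G" and g: "g = h \<otimes> s j"
      by (simp_all add: h_def)
    have lt: "len h < len g"
      using lt by (simp add: h_def)
    have "i \<noteq> j"
      using less.prems lt by (auto simp: h_def)
    then consider
      (commute) "s i \<otimes> s j = s j \<otimes> s i" "P i h \<Longrightarrow> P i (h \<otimes> s j)"
    | (braid) "s i \<otimes> s j \<otimes> s i = s j \<otimes> s i \<otimes> s j" "P i h \<Longrightarrow> P j h \<Longrightarrow> P i (h \<otimes> s j)"
        "\<And>k. k \<in> carrier G \<Longrightarrow> P j k \<Longrightarrow> P i (k \<otimes> s i \<otimes> s j)"
      using relation[of i j] by auto
    then show ?thesis
    proof cases
      case commute
      \<comment> \<open>A descent of \<open>h\<close> at \<open>i\<close> would make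
        \<open>g s\<^sub>i\<close> shorter than \<open>g\<close>.\<close>
      have "g \<otimes> s i = h \<otimes> s i \<otimes> s j"
        using commute(1) by (simp add: g m_assoc)
      then have "len (g \<otimes> s i) \<le> Suc (len (h \<otimes> s i))"
        using len_mult_s[of "h \<otimes> s i" j] by simp
      then have "len h \<le> len (h \<otimes> s i)"
        using less.prems lt by linarith
      then have "P i h"
        using less.hyps lt by simp
      then show ?thesis
        using commute(2) g by simp
    next
      case braid
      have "P j h"
        by (rule less.hyps) (use lt g in auto)
      show ?thesis
      proof (cases "len h \<le> len (h \<otimes> s i)")
        case True
        then have "P i h"
          using less.hyps lt by simp
        then show ?thesis
          using braid(2) \<open>P j h\<close> g by simp
      next
        case False
        \<comment> \<open>Now \<open>g\<close> is \<open>k s\<^sub>i s\<^sub>j\<close>. A descent of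
          \<open>k\<close> at \<open>j\<close> is impossible: by the braid relation
          \<open>g s\<^sub>i = k s\<^sub>j s\<^sub>i s\<^sub>j\<close> would then be shorter than
          \<open>g\<close>.\<close>
        define k where "k = h \<otimes> s i"
        have k [simp]: "k \<in> carrier G" and hk: "h = k \<otimes> s i"
          by (simp_all add: k_def)
        have "g \<otimes> s i = k \<otimes> s j \<otimes> s i \<otimes> s j"
          using braid(1) by (simp add: g hk m_assoc)
        then have "len (g \<otimes> s i) \<le> Suc (Suc (len (k \<otimes> s j)))"
          using len_mult_s[of "k \<otimes> s j \<otimes> s i" j] len_mult_s[of "k \<otimes> s j" i] by simp
        moreover have "len k < len h"
          using False by (simp add: k_def)
        ultimately have "len k \<le> len (k \<otimes> s j)"
          using less.prems lt by linarith
        then have "P j k"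
          using less.hyps lt \<open>len k < len h\<close> by simp
        then show ?thesis
          using braid(3) g hk by simp
      qed
    qed
  qed
qed

theorem ex_P_mult_s:
  assumes "g \<in> carrier G" "g \<noteq> \<one>"
  shows "\<exists>i\<in>I. P i (g \<otimes> s i)"
proof -
  obtain i where "i \<in> I" "len (g \<otimes> s i) < len g"
    using ex_descent assms by blast
  then have "P i (g \<otimes> s i)"
    by (intro P_if_ascent) (use assms in auto)
  with \<open>i \<in> I\<close> show ?thesis
    by blast
qed

end

section \<open>Coxeter generators of the progenitors\<close>

text \<open>The generators are indexed by the nodes of the Coxeter diagram, in which node 0 is attached
  to node \<open>k\<close> of the chain \<open>1, \<dots>, n - 1\<close>.\<close>

definition simple_elt :: "nat \<Rightarrow> nat \<Rightarrow> (nat \<Rightarrow> nat) \<times> (nat set \<times> int) list" where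
  "simple_elt k i = (if i = 0 then sym_gen {1..k} else perm_elt (transpose i (Suc i)))"

definition adjacent :: "nat \<Rightarrow> nat \<Rightarrow> nat \<Rightarrow> bool" where
  "adjacent k i j \<longleftrightarrow> i = 0 \<and> j = k \<or> i = k \<and> j = 0 \<or> i \<noteq> 0 \<and> j \<noteq> 0 \<and> (j = Suc i \<or> i = Suc j)"

lemma initial_subset_of_size: "k \<le> n \<Longrightarrow> {1..k} \<in> subsets_of_size n k"
  by (auto simp: subsets_of_size_def)

lemma simple_elt_closed: "k \<le> n \<Longrightarrow> i < n \<Longrightarrow> simple_elt k i \<in> carrier (progenitor n k)"
  unfolding simple_elt_def
  using initial_subset_of_size[of k n] sym_gen_closed perm_elt_closed[OF permutes_swap_id, of i n "Suc i"]
  by auto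

lemma simple_elt_square:
  "simple_elt k i \<otimes>\<^bsub>progenitor n k\<^esub> simple_elt k i = \<one>\<^bsub>progenitor n k\<^esub>"
  by (simp add: simple_elt_def sym_gen_square perm_elt_mult) (simp add: perm_elt_def one_progenitor)

lemma simple_elt_commute:
  assumes "\<not> adjacent k i j"
  shows "simple_elt k i \<otimes>\<^bsub>progenitor n k\<^esub> simple_elt k j =
    simple_elt k j \<otimes>\<^bsub>progenitor n k\<^esub> simple_elt k i"
proof -
  have 0: "sym_gen {1..k} \<otimes>\<^bsub>progenitor n k\<^esub> perm_elt (transpose j (Suc j)) =
      perm_elt (transpose j (Suc j)) \<otimes>\<^bsub>progenitor n k\<^esub> sym_gen {1..k}"
    if "j \<noteq> 0" "j \<noteq> k" for j
  proof -
    \<comment> \<open>As \<open>j\<close> is neither 0 nor \<open>k\<close>, both or none of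
      \<open>j\<close>, \<open>j + 1\<close> lie in \<open>{1..k}\<close>.\<close>
    have "transpose j (Suc j) ` {1..k} = {1..k}"
      using that by (intro transpose_image_eq) auto
    then show ?thesis
      by (simp only: sym_gen_perm_elt)
  qed
  show ?thesis
  proof (cases "i = 0 \<or> j = 0")
    case True
    then show ?thesis
      using assms 0 by (auto simp: simple_elt_def adjacent_def)
  next
    case False
    then have "transpose i (Suc i) \<circ> transpose j (Suc j) = transpose j (Suc j) \<circ> transpose i (Suc i)"
      using assms by (auto simp: adjacent_def fun_eq_iff transpose_def)
    then show ?thesis
      using False by (simp add: simple_elt_def perm_elt_mult)
  qed
qed

lemma simple_elt_braid:
  assumes "adjacent k i j" "i \<noteq> 0" "j \<noteq> 0"
  shows "simple_elt k i \<otimes>\<^bsub>progenitor n k\<^esub> simple_elt k j \<otimes>\<^bsub>progenitor n k\<^esub> simple_elt k i =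
    simple_elt k j \<otimes>\<^bsub>progenitor n k\<^esub> simple_elt k i \<otimes>\<^bsub>progenitor n k\<^esub> simple_elt k j"
proof -
  have "transpose i (Suc i) \<circ> (transpose j (Suc j) \<circ> transpose i (Suc i)) =
      transpose j (Suc j) \<circ> (transpose i (Suc i) \<circ> transpose j (Suc j))"
    using assms by (auto simp: adjacent_def fun_eq_iff transpose_def)
  then show ?thesis
    using assms by (simp add: simple_elt_def perm_elt_mult)
qed

text \<open>Transitivity of the symmetric group on subsets of equal size: a bijection from
  \<open>A\<close> to \<open>B\<close> is completed by one between the complements.\<close>

lemma ex_permutes_image:
  assumes "finite S" "A \<subseteq> S" "B \<subseteq> S" "card A = card B"
  shows "\<exists>p. p permutes S \<and> p ` A = B"
proof -
  have fin: "finite A" "finite B"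
    using assms finite_subset by blast+
  obtain f where f: "bij_betw f A B"
    using fin assms bij_betw_iff_card by blast
  have "card (S - A) = card (S - B)"
    using assms fin by (simp add: card_Diff_subset)
  then obtain g where g: "bij_betw g (S - A) (S - B)"
    using assms bij_betw_iff_card by blast
  let ?p = "\<lambda>x. if x \<in> S then if x \<in> A then f x else g x else x"
  have "bij_betw (\<lambda>x. if x \<in> A then f x else g x) (A \<union> (S - A)) (B \<union> (S - B))"
    by (rule bij_betw_disjoint_Un) (use f g in auto)
  then have "bij_betw (\<lambda>x. if x \<in> A then f x else g x) S S"
    using assms by (simp add: Un_absorb1)
  then have "bij_betw ?p S S"
    by (simp cong: bij_betw_cong)
  then have "?p permutes S"
    by (rule bij_imp_permutes) simp
  moreover have "?p ` A = B"
    using f assms by (force simp: bij_betw_def)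
  ultimately show ?thesis
    by blast
qed

text \<open>Adjacent transpositions give all of S_n, conjugation by S_n turns
  \<open>t\<^sub>A\<close> for \<open>A = {1..k}\<close> into every symmetric generator, and a
  reduced word is the product of its letters.\<close>

lemma generate_simple_elt:
  assumes "k \<le> n" "0 < n"
  shows "generate (progenitor n k) (simple_elt k ` {..<n}) = carrier (progenitor n k)"
    (is "generate ?G ?S = _")
proof -
  interpret group ?G
    by (rule group_progenitor)
  have S: "?S \<subseteq> carrier ?G"
    using simple_elt_closed assms by blast
  let ?H = "generate ?G ?S"
  have adj: "perm_elt (transpose i (Suc i)) \<in> ?H" if "i \<in> {1..<n}" for i
    using that generate.incl[of "simple_elt k i" ?S ?G] by (auto simp: simple_elt_def)
  have mult: "x \<otimes>\<^bsub>?G\<^esub> y \<in> ?H" if "x \<in> ?H" "y \<in> ?H" for x y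
    using that by (rule generate.eng)
  have "a \<noteq> 0 \<Longrightarrow> a < b \<Longrightarrow> b \<le> n \<Longrightarrow> perm_elt (transpose a b) \<in> ?H" for a b
  proof (induction b)
    case (Suc b)
    show ?case
    proof (cases "a = b")
      case True
      then show ?thesis
        using adj Suc.prems by simp
    next
      case False
      have "transpose a (Suc b) = transpose b (Suc b) \<circ> transpose a b \<circ> transpose b (Suc b)"
        using False Suc.prems by (auto simp: fun_eq_iff transpose_def)
      then have "perm_elt (transpose a (Suc b)) = perm_elt (transpose b (Suc b)) \<otimes>\<^bsub>?G\<^esub>
          (perm_elt (transpose a b) \<otimes>\<^bsub>?G\<^esub> perm_elt (transpose b (Suc b)))"
        by (simp add: perm_elt_mult)
      then show ?thesis
        using mult adj Suc False by simp
    qed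
  qed simp
  then have transp: "perm_elt (transpose a b) \<in> ?H" if "a \<in> {1..n}" "b \<in> {1..n}" "a \<noteq> b" for a b
    using that by (metis atLeastAtMost_iff linorder_neqE_nat not_one_le_zero transpose_commute)
  have perm: "perm_elt p \<in> ?H" if "p permutes {1..n}" for p
    using that finite_atLeastAtMost[of 1 n]
  proof (induction p rule: permutes_induct)
    case id
    then show ?case
      using generate.one[of ?G ?S] by (simp add: perm_elt_def one_progenitor id_def)
  next
    case (swap a b p)
    then show ?case
      using mult[OF swap.IH transp[of a b]] by (cases "a = b") (auto simp: perm_elt_mult comp_def)
  qed
  have gen: "sym_gen A \<in> ?H" if "A \<in> subsets_of_size n k" for A
  proof -
    obtain p where p: "p permutes {1..n}" "p ` {1..k} = A"
      using ex_permutes_image[of "{1..n}" "{1..k}" A] assms \<open>A \<in> _\<close> by (auto simp: subsets_of_size_def)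
    have "sym_gen A = perm_elt (inv_into UNIV p) \<otimes>\<^bsub>?G\<^esub> (sym_gen {1..k} \<otimes>\<^bsub>?G\<^esub> perm_elt p)"
      unfolding sym_gen_perm_elt p(2)
      using permutes_inv_o(1)[OF p(1)] p(2)
      by (simp add: perm_elt_def sym_gen_def mult_progenitor perm_act_def)
    moreover have "sym_gen {1..k} \<in> ?H"
      using generate.incl[of "simple_elt k 0" ?S ?G] assms by (simp add: simple_elt_def)
    ultimately show ?thesis
      using mult[OF perm[OF permutes_inv[OF p(1)]] mult[OF _ perm[OF p(1)]]] by simp
  qed
  have word: "(id, w) \<in> ?H" if "w \<in> involution_words (subsets_of_size n k)" for w
    using that
  proof (induction w)
    case Nil
    then show ?case
      using generate.one[of ?G ?S] by (simp add: one_progenitor id_def)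
  next
    case (Cons x w)
    obtain A where x: "x = (A, 1)" "A \<in> subsets_of_size n k"
      using Cons.prems by (cases x) (auto simp: involution_words_Cons)
    then have eq: "sym_gen A \<otimes>\<^bsub>?G\<^esub> (id, w) = (id, x # w)"
      using Cons.prems
      by (cases w; cases "hd w")
        (simp_all add: sym_gen_def mult_progenitor perm_act_def involution_words_Cons, blast)
    have "w \<in> involution_words (subsets_of_size n k)"
      using Cons.prems by (simp add: involution_words_Cons)
    then show ?case
      using mult[OF gen[OF x(2)] Cons.IH] by (simp only: eq)
  qed
  have "x \<in> ?H" if "x \<in> carrier ?G" for x
  proof -
    obtain p w where x: "x = (p, w)" "p permutes {1..n}" "w \<in> involution_words (subsets_of_size n k)"
      using \<open>x \<in> carrier ?G\<close> by (cases x) (auto simp: carrier_progenitor)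
    have "perm_elt p \<otimes>\<^bsub>?G\<^esub> (id, w) = x"
      by (simp add: x(1) perm_elt_def mult_progenitor perm_act_def)
    then show ?thesis
      using mult[OF perm[OF x(2)] word[OF x(3)]] by simp
  qed
  then show ?thesis
    using generate_in_carrier[OF S] by blast
qed

section \<open>Normal closures and relators of order three\<close>

lemma normal_normal_closure:
  assumes "group G" "S \<subseteq> carrier G"
  shows "normal_closure G S \<lhd> G"
proof -
  interpret group G by fact
  show ?thesis
    unfolding normal_closure_def
  proof (rule normal_generateI)
    fix h g
    assume "h \<in> {x \<otimes>\<^bsub>G\<^esub> s \<otimes>\<^bsub>G\<^esub> inv\<^bsub>G\<^esub> x | x s. x \<in> carrier G \<and> s \<in> S}" and g: "g \<in> carrier G"
    then obtain x s where h: "h = x \<otimes>\<^bsub>G\<^esub> s \<otimes>\<^bsub>G\<^esub> inv\<^bsub>G\<^esub> x" "x \<in> carrier G" "s \<in> S"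
      by blast
    then have "g \<otimes>\<^bsub>G\<^esub> h \<otimes>\<^bsub>G\<^esub> inv\<^bsub>G\<^esub> g = (g \<otimes>\<^bsub>G\<^esub> x) \<otimes>\<^bsub>G\<^esub> s \<otimes>\<^bsub>G\<^esub> inv\<^bsub>G\<^esub> (g \<otimes>\<^bsub>G\<^esub> x)"
      using assms g by (simp add: m_assoc inv_mult_group subset_iff)
    with h g show "g \<otimes>\<^bsub>G\<^esub> h \<otimes>\<^bsub>G\<^esub> inv\<^bsub>G\<^esub> g \<in> {x \<otimes>\<^bsub>G\<^esub> s \<otimes>\<^bsub>G\<^esub> inv\<^bsub>G\<^esub> x | x s. x \<in> carrier G \<and> s \<in> S}"
      by blast
  qed (use assms in auto)
qed

lemma subset_normal_closure:
  assumes "group G" "S \<subseteq> carrier G"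
  shows "S \<subseteq> normal_closure G S"
proof
  interpret group G by fact
  fix s assume "s \<in> S"
  then have "s = \<one>\<^bsub>G\<^esub> \<otimes>\<^bsub>G\<^esub> s \<otimes>\<^bsub>G\<^esub> inv\<^bsub>G\<^esub> \<one>\<^bsub>G\<^esub>"
    using assms by auto
  with \<open>s \<in> S\<close> show "s \<in> normal_closure G S"
    unfolding normal_closure_def by (intro generate.incl) blast
qed

lemma normal_closure_minimal:
  assumes "N \<lhd> G" "S \<subseteq> N"
  shows "normal_closure G S \<subseteq> N"
proof -
  interpret normal N G by fact
  show ?thesis
    unfolding normal_closure_def
    by (rule generate_subgroup_incl) (use assms inv_op_closed2 in \<open>auto simp: subset_iff subgroup_axioms\<close>)
qed

text \<open>The cube of \<open>x y\<close> is (xyx)(yxy), and xyx is its own inverse.\<close>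

lemma (in group) braid_if_order_three:
  assumes [simp]: "x \<in> carrier G" "y \<in> carrier G"
    and x: "x \<otimes> x = \<one>" and y: "y \<otimes> y = \<one>" and xy: "(x \<otimes> y) [^] (3::nat) = \<one>"
  shows "x \<otimes> y \<otimes> x = y \<otimes> x \<otimes> y"
proof -
  have "inv (x \<otimes> y \<otimes> x) = x \<otimes> y \<otimes> x"
    using inv_equality[OF x] inv_equality[OF y] by (simp add: inv_mult_group m_assoc)
  moreover have "(x \<otimes> y \<otimes> x) \<otimes> (y \<otimes> x \<otimes> y) = \<one>"
    using xy by (simp add: numeral_3_eq_3 m_assoc)
  ultimately show ?thesis
    using inv_equality[of "x \<otimes> y \<otimes> x" "y \<otimes> x \<otimes> y"] inv_inv by (metis assms(1,2) inv_comm m_closed inv_equality)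
qed

section \<open>Reflections\<close>

lemma reflection_norm_two:
  "\<alpha> \<bullet> \<alpha> = 2 \<Longrightarrow> reflection \<alpha> v = v - (v \<bullet> \<alpha>) \<cdot>\<^sub>v \<alpha>"
  by (simp add: reflection_def)

lemmas dot_distribs =
  add_scalar_prod_distrib[where n = m] scalar_prod_add_distrib[where n = m]
  minus_scalar_prod_distrib[where n = m] scalar_prod_minus_distrib[where n = m]
  smult_scalar_prod_distrib[where n = m] scalar_prod_smult_distrib[where n = m]
  for m :: nat

lemma reflection_closed [simp]:
  "\<alpha> \<in> carrier_vec m \<Longrightarrow> v \<in> carrier_vec m \<Longrightarrow> reflection \<alpha> v \<in> carrier_vec m"
  by (simp add: reflection_def)

lemma reflection_reflection:
  fixes \<alpha> v :: "real vec"
  assumes "\<alpha> \<in> carrier_vec m" "v \<in> carrier_vec m" "\<alpha> \<bullet> \<alpha> = 2"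
  shows "reflection \<alpha> (reflection \<alpha> v) = v"
  using assms by (intro eq_vecI) (auto simp: reflection_norm_two dot_distribs[where m = m])

text \<open>The reflection in \<open>\<alpha>\<close> sends \<open>\<beta>\<close> to
  \<open>\<alpha> + \<beta>\<close>, so the reflection in the sum is a conjugate.\<close>

lemma reflection_add:
  fixes \<alpha> \<beta> v :: "real vec"
  assumes "\<alpha> \<in> carrier_vec m" "\<beta> \<in> carrier_vec m" "v \<in> carrier_vec m"
    and "\<alpha> \<bullet> \<alpha> = 2" "\<beta> \<bullet> \<beta> = 2" "\<alpha> \<bullet> \<beta> = -1"
  shows "reflection (\<alpha> + \<beta>) v = reflection \<alpha> (reflection \<beta> (reflection \<alpha> v))"
proof -
  have "\<beta> \<bullet> \<alpha> = -1"
    using assms comm_scalar_prod[of \<alpha> m \<beta>] by simp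
  moreover from this have "(\<alpha> + \<beta>) \<bullet> (\<alpha> + \<beta>) = 2"
    using assms by (simp add: dot_distribs[where m = m])
  ultimately show ?thesis
    using assms
    by (intro eq_vecI) (auto simp: reflection_norm_two dot_distribs[where m = m] algebra_simps)
qed

text \<open>Both sides are the reflection in \<open>\<alpha> + \<beta>\<close>.\<close>

lemma reflection_braid:
  fixes \<alpha> \<beta> v :: "real vec"
  assumes "\<alpha> \<in> carrier_vec m" "\<beta> \<in> carrier_vec m" "v \<in> carrier_vec m"
    and "\<alpha> \<bullet> \<alpha> = 2" "\<beta> \<bullet> \<beta> = 2" "\<alpha> \<bullet> \<beta> = -1"
  shows "reflection \<alpha> (reflection \<beta> (reflection \<alpha> v)) = reflection \<beta> (reflection \<alpha> (reflection \<beta> v))"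
proof -
  have "\<beta> \<bullet> \<alpha> = -1"
    using assms comm_scalar_prod[of \<alpha> m \<beta>] by simp
  then show ?thesis
    using assms reflection_add[of \<alpha> m \<beta> v] reflection_add[of \<beta> m \<alpha> v] comm_add_vec[of \<alpha> m \<beta>]
    by simp
qed

lemma reflection_uminus:
  fixes \<alpha> v :: "real vec"
  assumes "\<alpha> \<in> carrier_vec m" "v \<in> carrier_vec m"
  shows "reflection (- \<alpha>) v = reflection \<alpha> v"
  using assms by (intro eq_vecI) (auto simp: reflection_def)

section \<open>The reflection representation\<close>

lemma action_hom_BijGroup:
  assumes "group G"
    and closed: "\<And>g v. g \<in> carrier G \<Longrightarrow> v \<in> V \<Longrightarrow> act g v \<in> V"
    and one: "\<And>v. v \<in> V \<Longrightarrow> act \<one>\<^bsub>G\<^esub> v = v"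
    and mult: "\<And>g h v. g \<in> carrier G \<Longrightarrow> h \<in> carrier G \<Longrightarrow> v \<in> V \<Longrightarrow>
      act (g \<otimes>\<^bsub>G\<^esub> h) v = act g (act h v)"
  shows "(\<lambda>g. restrict (act g) V) \<in> hom G (BijGroup V)"
proof -
  interpret group G by fact
  have Bij: "restrict (act g) V \<in> Bij V" if "g \<in> carrier G" for g
  proof -
    have "bij_betw (act g) V V"
      by (rule bij_betw_byWitness[of _ "act (inv\<^bsub>G\<^esub> g)"])
        (use that closed in \<open>auto simp: mult[symmetric] one\<close>)
    then show ?thesis
      by (simp add: Bij_def cong: bij_betw_cong)
  qed
  then show ?thesis
    by (auto simp: hom_def BijGroup_def compose_def mult closed fun_eq_iff restrict_def)
qed

definition lincomb :: "nat \<Rightarrow> ('i \<Rightarrow> real) \<Rightarrow> ('i \<Rightarrow> real vec) \<Rightarrow> 'i set \<Rightarrow> real vec" where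
  "lincomb m c f A = vec m (\<lambda>j. \<Sum>i\<in>A. c i * f i $ j)"

lemma lincomb_closed [simp]: "lincomb m c f A \<in> carrier_vec m"
  by (simp add: lincomb_def)

lemma lincomb_index [simp]: "j < m \<Longrightarrow> lincomb m c f A $ j = (\<Sum>i\<in>A. c i * f i $ j)"
  by (simp add: lincomb_def)

lemma lincomb_dim [simp]: "dim_vec (lincomb m c f A) = m"
  by (simp add: lincomb_def)

lemma lincomb_dot:
  "w \<in> carrier_vec m \<Longrightarrow> lincomb m c f A \<bullet> w = (\<Sum>i\<in>A. c i * (f i \<bullet> w))"
  by (auto simp: scalar_prod_def sum_distrib_left sum_distrib_right mult.assoc intro: sum.swap)

text \<open>Permutations act by permuting the orthonormal vectors \<open>f\<^sub>1, \<dots>, f\<^sub>n\<close> and fixing their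
  orthogonal complement, and the symmetric generator \<open>t\<^sub>A\<close> acts as the reflection in \<open>\<beta> A\<close>.
  The vector \<open>\<rho>\<close> only witnesses that the simple roots lie in an open half space.\<close>

locale progenitor_representation =
  fixes m n k :: nat and f :: "nat \<Rightarrow> real vec" and \<delta> :: "real vec" and d :: real and \<rho> :: "real vec"
  assumes k: "1 \<le> k" "k < n"
    and f_closed [simp]: "i \<in> {1..n} \<Longrightarrow> f i \<in> carrier_vec m"
    and \<delta>_closed [simp]: "\<delta> \<in> carrier_vec m"
    and \<rho>_closed [simp]: "\<rho> \<in> carrier_vec m"
    and f_dot_f: "i \<in> {1..n} \<Longrightarrow> j \<in> {1..n} \<Longrightarrow> f i \<bullet> f j = of_bool (i = j)"
    and f_dot_\<delta>: "i \<in> {1..n} \<Longrightarrow> f i \<bullet> \<delta> = d"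
    and \<delta>_dot_\<delta>: "\<delta> \<bullet> \<delta> = 2 + 2 * real k * d - real k"
    and \<rho>_f: "i \<in> {1..<n} \<Longrightarrow> f (Suc i) \<bullet> \<rho> < f i \<bullet> \<rho>"
    and \<rho>_\<delta>: "(\<Sum>i = 1..k. f i \<bullet> \<rho>) < \<delta> \<bullet> \<rho>"
begin

abbreviation V :: "real vec set" where
  "V \<equiv> carrier_vec m"

definition \<beta> :: "nat set \<Rightarrow> real vec" where
  "\<beta> A = \<delta> - lincomb m (\<lambda>_. 1) f A"

text \<open>The correction term gives the result the coordinate \<open>v \<bullet> f (p i)\<close>
  along \<open>f i\<close>. So \<open>f (p i)\<close> goes to \<open>f i\<close>: using the inverse
  of \<open>p\<close> turns the left-to-right product of permutations into a left action.\<close>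

definition \<sigma> :: "(nat \<Rightarrow> nat) \<Rightarrow> real vec \<Rightarrow> real vec" where
  "\<sigma> p v = v + lincomb m (\<lambda>i. v \<bullet> f (p i) - v \<bullet> f i) f {1..n}"

definition \<tau> :: "(nat set \<times> int) list \<Rightarrow> real vec \<Rightarrow> real vec" where
  "\<tau> w v = foldr (\<lambda>x. reflection (\<beta> (fst x))) w v"

definition act :: "(nat \<Rightarrow> nat) \<times> (nat set \<times> int) list \<Rightarrow> real vec \<Rightarrow> real vec" where
  "act = (\<lambda>(p, w) v. \<sigma> p (\<tau> w v))"

definition \<alpha> :: "nat \<Rightarrow> real vec" where
  "\<alpha> i = (if i = 0 then \<beta> {1..k} else f i - f (Suc i))"

abbreviation G :: "((nat \<Rightarrow> nat) \<times> (nat set \<times> int) list) monoid" where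
  "G \<equiv> progenitor n k"

lemma \<beta>_closed [simp]: "\<beta> A \<in> V"
  by (simp add: \<beta>_def)

lemma \<sigma>_closed [simp]: "v \<in> V \<Longrightarrow> \<sigma> p v \<in> V"
  by (simp add: \<sigma>_def)

lemma \<tau>_closed [simp]: "v \<in> V \<Longrightarrow> \<tau> w v \<in> V"
  by (induction w) (auto simp: \<tau>_def)

lemma sum_of_bool:
  fixes g :: "nat \<Rightarrow> real"
  shows "finite A \<Longrightarrow> (\<Sum>i\<in>A. g i * of_bool (i = j)) = (if j \<in> A then g j else 0)"
  by (simp add: of_bool_def if_distrib sum.delta cong: if_cong)

lemma lincomb_dot_f:
  assumes "A \<subseteq> {1..n}" "j \<in> {1..n}"
  shows "lincomb m c f A \<bullet> f j = (if j \<in> A then c j else 0)"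
proof -
  have "finite A"
    using assms finite_subset by blast
  have "lincomb m c f A \<bullet> f j = (\<Sum>i\<in>A. c i * of_bool (i = j))"
    using assms by (auto simp: lincomb_dot f_dot_f subset_iff intro!: sum.cong)
  then show ?thesis
    by (simp only: sum_of_bool[OF \<open>finite A\<close>])
qed

lemma \<beta>_dot_f:
  assumes "A \<subseteq> {1..n}" "j \<in> {1..n}"
  shows "\<beta> A \<bullet> f j = d - of_bool (j \<in> A)"
  using assms comm_scalar_prod[of \<delta> m "f j"] by (simp add: \<beta>_def dot_distribs[where m = m] lincomb_dot_f f_dot_\<delta>)

text \<open>Expanding gives \<open>\<delta> \<bullet> \<delta> - 2 k d + k\<close>; the locale
  assumption on \<open>\<delta> \<bullet> \<delta>\<close> is what makes this 2.\<close>

lemma \<beta>_dot_\<beta>: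
  assumes "A \<in> subsets_of_size n k"
  shows "\<beta> A \<bullet> \<beta> A = 2"
proof -
  have A: "A \<subseteq> {1..n}" "card A = k" "finite A"
    using assms finite_subset by (auto simp: subsets_of_size_def)
  have "f i \<bullet> \<beta> A = d - 1" if "i \<in> A" for i
    using \<beta>_dot_f[OF A(1), of i] A that comm_scalar_prod[of "f i" m "\<beta> A"] by auto
  then have 1: "lincomb m (\<lambda>_. 1) f A \<bullet> \<beta> A = k * (d - 1)"
    using A by (simp add: lincomb_dot)
  have 2: "lincomb m (\<lambda>_. 1) f A \<bullet> \<delta> = k * d"
    using A by (simp add: lincomb_dot f_dot_\<delta> subset_iff)
  have "\<beta> A \<bullet> \<beta> A = \<delta> \<bullet> \<beta> A - lincomb m (\<lambda>_. 1) f A \<bullet> \<beta> A"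
    by (subst (1) \<beta>_def) (simp add: dot_distribs[where m = m])
  also have "\<delta> \<bullet> \<beta> A = \<delta> \<bullet> \<delta> - lincomb m (\<lambda>_. 1) f A \<bullet> \<delta>"
    using comm_scalar_prod[of \<delta> m "lincomb m (\<lambda>_. 1) f A"] by (simp add: \<beta>_def dot_distribs[where m = m])
  finally show ?thesis
    unfolding 1 2 \<delta>_dot_\<delta> by (simp add: algebra_simps)
qed

section \<open>The action of permutations\<close>

lemma \<sigma>_dot_f:
  assumes "p permutes {1..n}" "v \<in> V" "i \<in> {1..n}"
  shows "\<sigma> p v \<bullet> f i = v \<bullet> f (p i)"
  using assms by (simp add: \<sigma>_def dot_distribs[where m = m] lincomb_dot_f)

text \<open>All \<open>f i\<close> pair equally with \<open>\<delta>\<close>, and a permutation of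
  the coordinates of \<open>v\<close> along them keeps their sum.\<close>

lemma \<sigma>_dot_\<delta>:
  assumes p: "p permutes {1..n}" and v: "v \<in> V"
  shows "\<sigma> p v \<bullet> \<delta> = v \<bullet> \<delta>"
proof -
  have "lincomb m (\<lambda>i. v \<bullet> f (p i) - v \<bullet> f i) f {1..n} \<bullet> \<delta> = (\<Sum>i = 1..n. (v \<bullet> f (p i) - v \<bullet> f i) * d)"
    unfolding lincomb_dot[OF \<delta>_closed] by (intro sum.cong) (simp_all add: f_dot_\<delta>)
  also have "\<dots> = 0"
    using sum.permute[OF p, of "\<lambda>i. v \<bullet> f i"] by (simp add: sum_subtractf flip: sum_distrib_right)
  finally show ?thesis
    using v by (simp add: \<sigma>_def dot_distribs[where m = m])
qed

lemma \<sigma>_id: "v \<in> V \<Longrightarrow> \<sigma> id v = v"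
  by (intro eq_vecI) (auto simp: \<sigma>_def)

lemma \<sigma>_\<sigma>:
  assumes p: "p permutes {1..n}" and q: "q permutes {1..n}" and v: "v \<in> V"
  shows "\<sigma> p (\<sigma> q v) = \<sigma> (q \<circ> p) v"
proof (rule eq_vecI)
  fix j assume "j < dim_vec (\<sigma> (q \<circ> p) v)"
  then have j: "j < m"
    by (simp add: \<sigma>_def)
  have "\<sigma> p (\<sigma> q v) $ j = v $ j + (\<Sum>i = 1..n. (v \<bullet> f (q i) - v \<bullet> f i) * f i $ j)
      + (\<Sum>i = 1..n. (\<sigma> q v \<bullet> f (p i) - \<sigma> q v \<bullet> f i) * f i $ j)"
    using j v by (simp add: \<sigma>_def)
  \<comment> \<open>By \<open>\<sigma>_dot_f\<close> the second correction starts where the first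
    one ends, so the two sums telescope.\<close>
  also have "(\<Sum>i = 1..n. (\<sigma> q v \<bullet> f (p i) - \<sigma> q v \<bullet> f i) * f i $ j) =
      (\<Sum>i = 1..n. (v \<bullet> f (q (p i)) - v \<bullet> f (q i)) * f i $ j)"
    using \<sigma>_dot_f[OF q v] permutes_in_image[OF p] by (intro sum.cong) auto
  finally have "\<sigma> p (\<sigma> q v) $ j = v $ j + (\<Sum>i = 1..n. (v \<bullet> f (q (p i)) - v \<bullet> f i) * f i $ j)"
    by (simp add: algebra_simps flip: sum.distrib)
  then show "\<sigma> p (\<sigma> q v) $ j = \<sigma> (q \<circ> p) v $ j"
    using j v by (simp add: \<sigma>_def)
qed (use v in \<open>simp add: \<sigma>_def\<close>)

lemma \<sigma>_add:
  assumes p: "p permutes {1..n}" and u: "u \<in> V" and v: "v \<in> V"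
  shows "\<sigma> p (u + v) = \<sigma> p u + \<sigma> p v"
proof -
  have "(u + v) \<bullet> f i = u \<bullet> f i + v \<bullet> f i" if "i \<in> {1..n}" for i
    using that u v by (simp add: dot_distribs[where m = m])
  then have "((u + v) \<bullet> f (p i) - (u + v) \<bullet> f i) * f i $ j =
      (u \<bullet> f (p i) - u \<bullet> f i) * f i $ j + (v \<bullet> f (p i) - v \<bullet> f i) * f i $ j" if "i \<in> {1..n}" for i j
    using that permutes_in_image[OF p, of i] by (simp add: algebra_simps)
  then show ?thesis
    using u v by (intro eq_vecI) (simp_all add: \<sigma>_def sum.distrib)
qed

lemma \<sigma>_smult:
  assumes p: "p permutes {1..n}" and v: "v \<in> V"
  shows "\<sigma> p (c \<cdot>\<^sub>v v) = c \<cdot>\<^sub>v \<sigma> p v"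
proof -
  have "(c \<cdot>\<^sub>v v) \<bullet> f i = c * (v \<bullet> f i)" if "i \<in> {1..n}" for i
    using that v by (simp add: dot_distribs[where m = m])
  then have "(\<Sum>i = 1..n. ((c \<cdot>\<^sub>v v) \<bullet> f (p i) - (c \<cdot>\<^sub>v v) \<bullet> f i) * f i $ j) =
      c * (\<Sum>i = 1..n. (v \<bullet> f (p i) - v \<bullet> f i) * f i $ j)" for j
    unfolding sum_distrib_left
    using permutes_in_image[OF p] by (intro sum.cong) (auto simp: algebra_simps)
  then show ?thesis
    using v by (intro eq_vecI) (simp_all add: \<sigma>_def distrib_left)
qed

lemma \<sigma>_\<beta>:
  assumes p: "p permutes {1..n}" and A: "A \<subseteq> {1..n}"
  shows "\<sigma> p (\<beta> (p ` A)) = \<beta> A"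
proof (rule eq_vecI)
  fix j assume "j < dim_vec (\<beta> A)"
  then have j: "j < m"
    by (simp add: \<beta>_def)
  have restrict: "(\<Sum>i = 1..n. of_bool (i \<in> B) * f i $ j) = (\<Sum>i\<in>B. f i $ j)" if "B \<subseteq> {1..n}" for B
    using that by (intro sum.mono_neutral_cong_right) auto
  have pA: "p ` A \<subseteq> {1..n}"
    using A permutes_image[OF p] by blast
  have "\<beta> (p ` A) \<bullet> f (p i) - \<beta> (p ` A) \<bullet> f i = of_bool (i \<in> p ` A) - of_bool (i \<in> A)"
    if "i \<in> {1..n}" for i
    using \<beta>_dot_f[OF pA] that permutes_in_image[OF p, of i] inj_image_mem_iff[OF permutes_inj[OF p]]
    by simp
  then have "\<sigma> p (\<beta> (p ` A)) $ j = \<beta> (p ` A) $ j +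
      (\<Sum>i = 1..n. (of_bool (i \<in> p ` A) - of_bool (i \<in> A)) * f i $ j)"
    using j by (simp add: \<sigma>_def \<beta>_def)
  also have "\<dots> = \<beta> A $ j"
    using j by (simp add: \<beta>_def left_diff_distrib sum_subtractf restrict[OF A, simplified]
        restrict[OF pA, simplified])
  finally show "\<sigma> p (\<beta> (p ` A)) $ j = \<beta> A $ j" .
qed (simp add: \<beta>_def \<sigma>_def)

lemma dot_\<beta>:
  assumes "v \<in> V" "A \<subseteq> {1..n}"
  shows "v \<bullet> \<beta> A = v \<bullet> \<delta> - (\<Sum>i\<in>A. v \<bullet> f i)"
proof -
  have "v \<bullet> lincomb m (\<lambda>_. 1) f A = (\<Sum>i\<in>A. f i \<bullet> v)"
    using assms comm_scalar_prod[of v m "lincomb m (\<lambda>_. 1) f A"] by (simp add: lincomb_dot)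
  also have "\<dots> = (\<Sum>i\<in>A. v \<bullet> f i)"
    using assms comm_scalar_prod[of v m] by (intro sum.cong) (auto simp: subset_iff)
  finally show ?thesis
    using assms by (simp add: \<beta>_def dot_distribs[where m = m])
qed

lemma \<sigma>_dot_\<beta>:
  assumes p: "p permutes {1..n}" and A: "A \<subseteq> {1..n}" and v: "v \<in> V"
  shows "\<sigma> p v \<bullet> \<beta> A = v \<bullet> \<beta> (p ` A)"
proof -
  have "p ` A \<subseteq> {1..n}"
    using A permutes_image[OF p] by blast
  then have "v \<bullet> \<beta> (p ` A) = v \<bullet> \<delta> - (\<Sum>i\<in>A. v \<bullet> f (p i))"
    using v by (simp add: dot_\<beta> sum.reindex permutes_inj_on[OF p])
  also have "(\<Sum>i\<in>A. v \<bullet> f (p i)) = (\<Sum>i\<in>A. \<sigma> p v \<bullet> f i)"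
    using A \<sigma>_dot_f[OF p v] by (intro sum.cong) auto
  finally show ?thesis
    using v A by (simp add: dot_\<beta> \<sigma>_dot_\<delta>[OF p])
qed

text \<open>The operator form of \<open>sym_gen_perm_elt\<close>, and the reason why
  \<open>act\<close> respects the semidirect product.\<close>

lemma reflection_\<sigma>:
  assumes p: "p permutes {1..n}" and A: "A \<in> subsets_of_size n k" and v: "v \<in> V"
  shows "reflection (\<beta> A) (\<sigma> p v) = \<sigma> p (reflection (\<beta> (p ` A)) v)"
proof -
  have A': "A \<subseteq> {1..n}"
    using A by (simp add: subsets_of_size_def)
  have eq: "v - c \<cdot>\<^sub>v w = v + (- c) \<cdot>\<^sub>v w" if "v \<in> V" "w \<in> V" for v w and c :: real
    using that by (intro eq_vecI) auto
  have "reflection (\<beta> (p ` A)) v = v + (- (v \<bullet> \<beta> (p ` A))) \<cdot>\<^sub>v \<beta> (p ` A)"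
    using v \<beta>_dot_\<beta>[OF permutes_image_subsets_of_size[OF p A]] by (simp add: reflection_norm_two eq)
  then have "\<sigma> p (reflection (\<beta> (p ` A)) v) = \<sigma> p v + (- (v \<bullet> \<beta> (p ` A))) \<cdot>\<^sub>v \<beta> A"
    using v by (simp add: \<sigma>_add[OF p] \<sigma>_smult[OF p] \<sigma>_\<beta>[OF p A'])
  then show ?thesis
    using v \<beta>_dot_\<beta>[OF A] by (simp add: reflection_norm_two eq \<sigma>_dot_\<beta>[OF p A' v])
qed

section \<open>The action of words and of the whole progenitor\<close>

lemma \<tau>_Cons: "\<tau> (x # w) v = reflection (\<beta> (fst x)) (\<tau> w v)"
  by (simp add: \<tau>_def)

lemma \<tau>_\<sigma>:
  assumes p: "p permutes {1..n}" and v: "v \<in> V"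
  shows "w \<in> involution_words (subsets_of_size n k) \<Longrightarrow> \<tau> w (\<sigma> p v) = \<sigma> p (\<tau> (perm_act p w) v)"
proof (induction w)
  case (Cons x w)
  then have "\<tau> (x # w) (\<sigma> p v) = \<sigma> p (reflection (\<beta> (p ` fst x)) (\<tau> (perm_act p w) v))"
    using v by (simp add: \<tau>_Cons involution_words_Cons reflection_\<sigma>[OF p])
  then show ?case
    by (cases x) (simp add: perm_act_def \<tau>_Cons)
qed (simp add: \<tau>_def perm_act_def)

text \<open>Cancelling two equal letters does not change the operator, because a reflection is an
  involution.\<close>

lemma \<tau>_foldr:
  assumes w: "w \<in> involution_words (subsets_of_size n k)" and v: "v \<in> V"
  shows "u \<in> involution_words (subsets_of_size n k) \<Longrightarrow>
    \<tau> (foldr involution_letter u w) v = \<tau> u (\<tau> w v)"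
proof (induction u)
  case (Cons x u)
  define y where "y = foldr involution_letter u w"
  have y: "y \<in> involution_words (subsets_of_size n k)"
    unfolding y_def using Cons.prems w
    by (intro foldr_involution_letter_closed) (auto simp: involution_words_Cons)
  obtain A where x: "x = (A, 1)" "A \<in> subsets_of_size n k"
    using Cons.prems by (cases x) (auto simp: involution_words_Cons)
  have "\<tau> (involution_letter (A, 1) y) v = reflection (\<beta> A) (\<tau> y v)"
  proof (cases "y \<noteq> [] \<and> hd y = (A, 1)")
    case True
    then obtain y' where y': "y = (A, 1) # y'"
      by (cases y) auto
    then show ?thesis
      using v x by (simp add: \<tau>_Cons reflection_reflection[where m = m] \<beta>_dot_\<beta>)
  next
    case False
    then show ?thesis
      by (subst involution_letter_eq[OF y]) (auto simp: \<tau>_Cons)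
  qed
  then show ?case
    using Cons x by (simp add: y_def involution_words_Cons \<tau>_Cons)
qed (simp add: \<tau>_def)

lemma act_closed [simp]: "v \<in> V \<Longrightarrow> act g v \<in> V"
  by (cases g) (simp add: act_def)

lemma act_one: "v \<in> V \<Longrightarrow> act \<one>\<^bsub>G\<^esub> v = v"
  by (simp add: act_def one_progenitor \<tau>_def \<sigma>_id)

lemma act_mult:
  assumes "g \<in> carrier G" "h \<in> carrier G" "v \<in> V"
  shows "act (g \<otimes>\<^bsub>G\<^esub> h) v = act g (act h v)"
proof -
  obtain p u q w where gh: "g = (p, u)" "h = (q, w)"
    by fastforce
  then have closed: "p permutes {1..n}" "q permutes {1..n}"
      "u \<in> involution_words (subsets_of_size n k)" "w \<in> involution_words (subsets_of_size n k)"
    using assms by (auto simp: carrier_progenitor)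
  then show ?thesis
    using assms
    by (simp add: gh act_def mult_progenitor \<tau>_\<sigma> \<sigma>_\<sigma> \<tau>_foldr perm_act_closed del: comp_apply)
qed

lemma act_add:
  assumes "g \<in> carrier G" "u \<in> V" "v \<in> V"
  shows "act g (u + v) = act g u + act g v"
proof -
  obtain p w where g: "g = (p, w)"
    by fastforce
  have "reflection a (u + v) = reflection a u + reflection a v" if "a \<in> V" "u \<in> V" "v \<in> V" for a u v
    using that by (intro eq_vecI) (auto simp: reflection_def dot_distribs[where m = m] algebra_simps add_divide_distrib)
  then have "\<tau> w (u + v) = \<tau> w u + \<tau> w v"
    using assms by (induction w) (simp_all add: \<tau>_Cons, simp_all add: \<tau>_def)
  then show ?thesis
    using assms g by (auto simp: act_def carrier_progenitor \<sigma>_add)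
qed

end

section \<open>Simple roots and the positive cone\<close>

context progenitor_representation
begin

lemma \<alpha>_closed [simp]: "i < n \<Longrightarrow> \<alpha> i \<in> V"
  by (simp add: \<alpha>_def)

lemmas dims [simp] =
  carrier_vecD[OF f_closed] carrier_vecD[OF \<delta>_closed] carrier_vecD[OF \<rho>_closed] carrier_vecD[OF \<alpha>_closed]

lemma \<alpha>_dot_\<alpha>:
  assumes "i < n" "j < n"
  shows "\<alpha> i \<bullet> \<alpha> j = (if i = j then 2 else if adjacent k i j then - 1 else 0)"
proof -
  have K: "{1..k} \<subseteq> {1..n}"
    using k by auto
  \<comment> \<open>The inner products of \<open>\<beta> {1..k}\<close> with the \<open>f i\<close>
    are \<open>d - 1\<close> up to \<open>k\<close> and \<open>d\<close> beyond; a difference sees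
    only the jump at \<open>k\<close>.\<close>
  have 0: "\<alpha> 0 \<bullet> \<alpha> j = (if j = k then - 1 else 0)" if "j \<noteq> 0" "j < n" for j
    using that k by (simp add: \<alpha>_def dot_distribs[where m = m] \<beta>_dot_f[OF K, simplified])
  show ?thesis
  proof (cases "i = 0 \<or> j = 0")
    case True
    then consider "i = 0" "j = 0" | "i = 0" "j \<noteq> 0" | "i \<noteq> 0" "j = 0"
      by blast
    then show ?thesis
    proof cases
      case 1
      then show ?thesis
        using \<beta>_dot_\<beta>[OF initial_subset_of_size] k by (simp add: \<alpha>_def)
    next
      case 2
      then show ?thesis
        using 0 assms k by (auto simp: adjacent_def)
    next
      case 3
      then have "\<alpha> i \<bullet> \<alpha> j = \<alpha> 0 \<bullet> \<alpha> i"
        using assms by (simp add: comm_scalar_prod[where n = m])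
      then show ?thesis
        using 0 3 assms k by (auto simp: adjacent_def)
    qed
  next
    case False
    then show ?thesis
      using assms by (auto simp: \<alpha>_def dot_distribs[where m = m] f_dot_f adjacent_def)
  qed
qed

text \<open>A transposition changes only the coordinates along \<open>f i\<close> and
  \<open>f (i + 1)\<close>, by opposite amounts, which is the reflection in their
  difference.\<close>

lemma act_simple_elt:
  assumes i: "i < n" and v: "v \<in> V"
  shows "act (simple_elt k i) v = reflection (\<alpha> i) v"
proof (cases "i = 0")
  case True
  then show ?thesis
    using v by (simp add: act_def simple_elt_def sym_gen_def \<tau>_def \<alpha>_def \<sigma>_id)
next
  case False
  have "\<sigma> (transpose i (Suc i)) v = v - (v \<bullet> \<alpha> i) \<cdot>\<^sub>v \<alpha> i"
  proof (rule eq_vecI)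
    fix j assume "j < dim_vec (v - (v \<bullet> \<alpha> i) \<cdot>\<^sub>v \<alpha> i)"
    then have j: "j < m"
      using i by simp
    have "(\<Sum>l = 1..n. (v \<bullet> f (transpose i (Suc i) l) - v \<bullet> f l) * f l $ j) =
        (\<Sum>l\<in>{i, Suc i}. (v \<bullet> f (transpose i (Suc i) l) - v \<bullet> f l) * f l $ j)"
      using False i by (intro sum.mono_neutral_right) auto
    also have "\<dots> = - (v \<bullet> (f i - f (Suc i))) * (f i $ j - f (Suc i) $ j)"
      using False i v by (simp add: dot_distribs[where m = m] algebra_simps)
    finally show "\<sigma> (transpose i (Suc i)) v $ j = (v - (v \<bullet> \<alpha> i) \<cdot>\<^sub>v \<alpha> i) $ j"
      using j v False i
      by (simp add: \<sigma>_def \<alpha>_def)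
  qed (use v i in \<open>simp add: \<sigma>_def\<close>)
  then show ?thesis
    using False \<alpha>_dot_\<alpha>[OF i i] by (simp add: act_def simple_elt_def perm_elt_def \<tau>_def reflection_norm_two)
qed

text \<open>Nonempty sums of simple roots. Zero stays outside, so every element pairs strictly
  positively with \<open>\<rho>\<close>.\<close>

inductive_set cone :: "real vec set" where
  simple: "i < n \<Longrightarrow> \<alpha> i \<in> cone"
| add: "u \<in> cone \<Longrightarrow> v \<in> cone \<Longrightarrow> u + v \<in> cone"

lemma \<alpha>_dot_\<rho>:
  assumes "i < n"
  shows "0 < \<alpha> i \<bullet> \<rho>"
proof (cases "i = 0")
  case True
  then show ?thesis
    using \<rho>_\<delta> by (simp add: \<alpha>_def \<beta>_def dot_distribs[where m = m] lincomb_dot)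
next
  case False
  then show ?thesis
    using assms \<rho>_f[of i] by (simp add: \<alpha>_def dot_distribs[where m = m])
qed

lemma cone_dot_\<rho>: "v \<in> cone \<Longrightarrow> v \<in> V \<and> 0 < v \<bullet> \<rho>"
  by (induction rule: cone.induct) (auto simp: \<alpha>_dot_\<rho> dot_distribs[where m = m])

lemma uminus_\<alpha>_notin_cone:
  assumes "i < n"
  shows "- \<alpha> i \<notin> cone"
proof
  assume "- \<alpha> i \<in> cone"
  then have "0 < - (\<alpha> i \<bullet> \<rho>)"
    using cone_dot_\<rho>[of "- \<alpha> i"] assms by simp
  then show False
    using \<alpha>_dot_\<rho>[OF assms] by simp
qed

section \<open>The quotient, the kernel and the image of its action\<close>

abbreviation \<phi> :: "(nat \<Rightarrow> nat) \<times> (nat set \<times> int) list \<Rightarrow> real vec \<Rightarrow> real vec" where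
  "\<phi> g \<equiv> restrict (act g) V"

lemma \<phi>_hom: "group_hom G (BijGroup V) \<phi>"
  by (intro group_hom.intro group_hom_axioms.intro action_hom_BijGroup group_progenitor group_BijGroup)
    (simp_all add: act_one act_mult)

definition r :: "(nat \<Rightarrow> nat) \<times> (nat set \<times> int) list" where
  "r = relator n k {1..k} k (Suc k)"

definition N :: "((nat \<Rightarrow> nat) \<times> (nat set \<times> int) list) set" where
  "N = normal_closure G {r}"

lemma relator_eq: "r = (simple_elt k 0 \<otimes>\<^bsub>G\<^esub> simple_elt k k) [^]\<^bsub>G\<^esub> (3::nat)"
  using k by (simp add: r_def relator_def simple_elt_def)

lemma simple_elt_closed' [simp]: "i < n \<Longrightarrow> simple_elt k i \<in> carrier G"
  using k by (simp add: simple_elt_closed)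

lemma relator_in_kernel: "r \<in> kernel G (BijGroup V) \<phi>"
proof -
  interpret group G
    by (rule group_progenitor)
  have n: "0 < n" "k < n" "k \<noteq> 0"
    using k by auto
  let ?a = "simple_elt k 0" and ?b = "simple_elt k k"
  have closed: "?a \<in> carrier G" "?b \<in> carrier G"
    using n by simp_all
  \<comment> \<open>The cube of \<open>a b\<close> is regrouped as (aba)(bab); both factors act as
    the same reflection.\<close>
  have "r = (?a \<otimes>\<^bsub>G\<^esub> (?b \<otimes>\<^bsub>G\<^esub> ?a)) \<otimes>\<^bsub>G\<^esub> (?b \<otimes>\<^bsub>G\<^esub> (?a \<otimes>\<^bsub>G\<^esub> ?b))"
    using closed by (simp add: relator_eq numeral_3_eq_3 m_assoc)
  moreover have "act ((?a \<otimes>\<^bsub>G\<^esub> (?b \<otimes>\<^bsub>G\<^esub> ?a)) \<otimes>\<^bsub>G\<^esub> (?b \<otimes>\<^bsub>G\<^esub> (?a \<otimes>\<^bsub>G\<^esub> ?b))) v = v" if "v \<in> V" for v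
  proof -
    have "act (?b \<otimes>\<^bsub>G\<^esub> (?a \<otimes>\<^bsub>G\<^esub> ?b)) v = act (?a \<otimes>\<^bsub>G\<^esub> (?b \<otimes>\<^bsub>G\<^esub> ?a)) v"
      using closed n that reflection_braid[of "\<alpha> 0" m "\<alpha> k" v]
      by (simp add: act_mult act_simple_elt \<alpha>_dot_\<alpha> adjacent_def)
    then show ?thesis
      using closed n that
      by (simp add: act_mult act_simple_elt reflection_reflection[where m = m] \<alpha>_dot_\<alpha>)
  qed
  ultimately show ?thesis
    using closed by (auto simp: kernel_def BijGroup_def)
qed

lemma N_normal: "N \<lhd> G"
  and N_subset_kernel: "N \<subseteq> kernel G (BijGroup V) \<phi>"
  and relator_in_N: "r \<in> N"
proof -
  interpret group_hom G "BijGroup V" \<phi>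
    by (rule \<phi>_hom)
  have r: "{r} \<subseteq> carrier G"
    using relator_in_kernel by (auto simp: kernel_def)
  show "N \<lhd> G"
    unfolding N_def by (rule normal_normal_closure[OF group_progenitor r])
  show "N \<subseteq> kernel G (BijGroup V) \<phi>"
    unfolding N_def by (rule normal_closure_minimal[OF normal_kernel]) (use relator_in_kernel in simp)
  show "r \<in> N"
    unfolding N_def using subset_normal_closure[OF group_progenitor r] by blast
qed

definition s :: "nat \<Rightarrow> ((nat \<Rightarrow> nat) \<times> (nat set \<times> int) list) set" where
  "s i = N #>\<^bsub>G\<^esub> simple_elt k i"

text \<open>One representative decides: elements of \<open>N\<close> act trivially, so
  \<open>positive_coset\<close> holds for any other.\<close>

definition positive :: "nat \<Rightarrow> ((nat \<Rightarrow> nat) \<times> (nat set \<times> int) list) set \<Rightarrow> bool" where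
  "positive i X \<longleftrightarrow> (\<exists>g\<in>carrier G. X = N #>\<^bsub>G\<^esub> g \<and> act g (\<alpha> i) \<in> cone)"

lemma positive_coset:
  assumes g: "g \<in> carrier G" and i: "i < n"
  shows "positive i (N #>\<^bsub>G\<^esub> g) \<longleftrightarrow> act g (\<alpha> i) \<in> cone"
proof -
  interpret group_hom G "BijGroup V" \<phi>
    by (rule \<phi>_hom)
  obtain \<psi> where \<psi>: "\<And>g. g \<in> carrier G \<Longrightarrow> \<psi> (N #>\<^bsub>G\<^esub> g) = \<phi> g"
    using FactGroup_universal_kernel[OF N_normal N_subset_kernel] by blast
  have "act h (\<alpha> i) = act g (\<alpha> i)" if "h \<in> carrier G" "N #>\<^bsub>G\<^esub> g = N #>\<^bsub>G\<^esub> h" for h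
  proof -
    have "\<phi> h = \<phi> g"
      using that g \<psi> by metis
    then show ?thesis
      using \<alpha>_closed[OF i] by (metis restrict_apply')
  qed
  then show ?thesis
    unfolding positive_def using g by metis
qed

lemma simply_laced_quotient: "simply_laced (G Mod N) {..<n} s positive"
proof -
  interpret G: group G
    by (rule group_progenitor)
  interpret N: normal N G
    by (rule N_normal)
  interpret Q: group "G Mod N"
    by (rule N.factorgroup_is_group)
  have hom: "group_hom G (G Mod N) (\<lambda>g. N #>\<^bsub>G\<^esub> g)"
    by (intro group_hom.intro group_hom_axioms.intro G.group_axioms Q.group_axioms N.r_coset_hom_Mod)
  have mult: "(N #>\<^bsub>G\<^esub> g) \<otimes>\<^bsub>G Mod N\<^esub> s i = N #>\<^bsub>G\<^esub> (g \<otimes>\<^bsub>G\<^esub> simple_elt k i)"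
    if "g \<in> carrier G" "i < n" for g i
    using that by (simp add: s_def N.rcos_sum)
  have coset: "\<exists>g\<in>carrier G. X = N #>\<^bsub>G\<^esub> g" if "X \<in> carrier (G Mod N)" for X
    using that unfolding carrier_FactGroup by blast
  have closed: "s i \<in> carrier (G Mod N)" if "i < n" for i
    using that unfolding s_def carrier_FactGroup by (intro imageI) simp
  have square: "s i \<otimes>\<^bsub>G Mod N\<^esub> s i = \<one>\<^bsub>G Mod N\<^esub>" if "i < n" for i
    using that mult[of "simple_elt k i" i]
    by (simp add: s_def simple_elt_square G.coset_mult_one N.subset)
  have act_\<alpha>: "act (g \<otimes>\<^bsub>G\<^esub> simple_elt k j) (\<alpha> i) =
      (if adjacent k i j then act g (\<alpha> i) + act g (\<alpha> j) else act g (\<alpha> i))"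
    if "g \<in> carrier G" "i < n" "j < n" "i \<noteq> j" for g i j
  proof -
    have "reflection (\<alpha> j) (\<alpha> i) = (if adjacent k i j then \<alpha> i + \<alpha> j else \<alpha> i)"
      using that by (intro eq_vecI) (auto simp: reflection_norm_two \<alpha>_dot_\<alpha>)
    then show ?thesis
      using that by (simp add: act_mult act_simple_elt act_add)
  qed
  show ?thesis
  proof (unfold_locales, goal_cases)
    case (1 i)
    then show ?case
      using closed by simp
  next
    case (2 i)
    then show ?case
      using square by simp
  next
    case 3
    have "generate (G Mod N) ((\<lambda>g. N #>\<^bsub>G\<^esub> g) ` simple_elt k ` {..<n}) =
        (\<lambda>g. N #>\<^bsub>G\<^esub> g) ` generate G (simple_elt k ` {..<n})"
      by (rule group_hom.generate_img[OF hom]) auto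
    then show ?case
      using k by (simp add: s_def image_image generate_simple_elt carrier_FactGroup)
  next
    case (4 i)
    have "\<one>\<^bsub>G Mod N\<^esub> = N #>\<^bsub>G\<^esub> \<one>\<^bsub>G\<^esub>"
      by (simp add: G.coset_mult_one N.subset)
    then show ?case
      using 4 positive_coset[of "\<one>\<^bsub>G\<^esub>" i] by (simp add: act_one cone.simple)
  next
    case (5 i j)
    then have ij: "i < n" "j < n" "i \<noteq> j"
      by simp_all
    show ?case
    proof (cases "adjacent k i j")
      case False
      have "s i \<otimes>\<^bsub>G Mod N\<^esub> s j = s j \<otimes>\<^bsub>G Mod N\<^esub> s i"
        using ij simple_elt_commute[OF False] by (simp add: s_def[of i] s_def[of j] N.rcos_sum)
      moreover have "positive i (X \<otimes>\<^bsub>G Mod N\<^esub> s j)" if "X \<in> carrier (G Mod N)" "positive i X" for X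
      proof -
        obtain g where "g \<in> carrier G" "X = N #>\<^bsub>G\<^esub> g"
          using coset \<open>X \<in> _\<close> by blast
        then show ?thesis
          using \<open>positive i X\<close> ij False by (simp add: mult positive_coset act_\<alpha> del: mult_FactGroup)
      qed
      ultimately show ?thesis
        by blast
    next
      case True
      have "s i \<otimes>\<^bsub>G Mod N\<^esub> s j \<otimes>\<^bsub>G Mod N\<^esub> s i = s j \<otimes>\<^bsub>G Mod N\<^esub> s i \<otimes>\<^bsub>G Mod N\<^esub> s j"
      proof (cases "i = 0 \<or> j = 0")
        case False
        then show ?thesis
          using ij simple_elt_braid[OF True] mult
          by (simp add: s_def[of i] s_def[of j] N.rcos_sum)
      next
        case zero: True
        \<comment> \<open>The only edge at node 0 leads to \<open>k\<close>, and its braid relation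
          is the relator.\<close>
        have "(s 0 \<otimes>\<^bsub>G Mod N\<^esub> s k) [^]\<^bsub>G Mod N\<^esub> (3::nat) = N #>\<^bsub>G\<^esub> r"
          using k by (simp add: s_def N.rcos_sum N.FactGroup_pow relator_eq)
        also have "\<dots> = \<one>\<^bsub>G Mod N\<^esub>"
          using relator_in_N by (simp add: N.rcos_const)
        finally have "s 0 \<otimes>\<^bsub>G Mod N\<^esub> s k \<otimes>\<^bsub>G Mod N\<^esub> s 0 = s k \<otimes>\<^bsub>G Mod N\<^esub> s 0 \<otimes>\<^bsub>G Mod N\<^esub> s k"
          using k by (intro Q.braid_if_order_three closed square) auto
        then show ?thesis
          using True zero by (auto simp: adjacent_def)
      qed
      moreover have "positive i (X \<otimes>\<^bsub>G Mod N\<^esub> s j)"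
        if "X \<in> carrier (G Mod N)" "positive i X" "positive j X" for X
      proof -
        obtain g where "g \<in> carrier G" "X = N #>\<^bsub>G\<^esub> g"
          using coset \<open>X \<in> _\<close> by blast
        then show ?thesis
          using that(2,3) ij True by (simp add: mult positive_coset act_\<alpha> cone.add del: mult_FactGroup)
      qed
      moreover have "positive i (X \<otimes>\<^bsub>G Mod N\<^esub> s i \<otimes>\<^bsub>G Mod N\<^esub> s j)"
        if "X \<in> carrier (G Mod N)" "positive j X" for X
      proof -
        obtain g where g: "g \<in> carrier G" "X = N #>\<^bsub>G\<^esub> g"
          using coset \<open>X \<in> _\<close> by blast
        \<comment> \<open>In short, \<open>s\<^sub>i s\<^sub>j\<close> sends
          \<open>\<alpha> i\<close> to \<open>s\<^sub>i (\<alpha> i + \<alpha> j)\<close>, which is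
          \<open>\<alpha> j\<close>.\<close>
        have "act (g \<otimes>\<^bsub>G\<^esub> simple_elt k i \<otimes>\<^bsub>G\<^esub> simple_elt k j) (\<alpha> i) =
            act (g \<otimes>\<^bsub>G\<^esub> simple_elt k i) (\<alpha> i + \<alpha> j)"
          using g ij True by (simp add: act_\<alpha> act_add)
        also have "\<dots> = act g (reflection (\<alpha> i) (\<alpha> i + \<alpha> j))"
          using g ij by (simp add: act_mult act_simple_elt)
        also have "reflection (\<alpha> i) (\<alpha> i + \<alpha> j) = \<alpha> j"
          using ij True
          by (intro eq_vecI) (auto simp: reflection_norm_two dot_distribs[where m = m] \<alpha>_dot_\<alpha> adjacent_def)
        finally show ?thesis
          using that g ij by (simp add: mult positive_coset del: mult_FactGroup)
      qed
      ultimately show ?thesis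
        by blast
    qed
  qed
qed

lemma kernel_eq: "kernel G (BijGroup V) \<phi> = N"
proof
  interpret G: group G
    by (rule group_progenitor)
  interpret N: normal N G
    by (rule N_normal)
  interpret simply_laced "G Mod N" "{..<n}" s positive
    by (rule simply_laced_quotient)
  show "kernel G (BijGroup V) \<phi> \<subseteq> N"
  proof
    fix g assume "g \<in> kernel G (BijGroup V) \<phi>"
    then have g: "g \<in> carrier G" and "\<phi> g = (\<lambda>v\<in>V. v)"
      by (simp_all add: kernel_def BijGroup_def)
    then have fix_g: "act g v = v" if "v \<in> V" for v
      using that by (metis restrict_apply')
    have X: "N #>\<^bsub>G\<^esub> g \<in> carrier (G Mod N)"
      unfolding carrier_FactGroup using g by (rule imageI)
    \<comment> \<open>As \<open>g\<close> acts as the identity, \<open>g s\<^sub>i\<close> negates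
      \<open>\<alpha> i\<close> for every \<open>i\<close>; by \<open>ex_P_mult_s\<close> only the
      trivial coset allows this.\<close>
    have "\<not> positive i ((N #>\<^bsub>G\<^esub> g) \<otimes>\<^bsub>G Mod N\<^esub> s i)" if "i < n" for i
    proof -
      have "reflection (\<alpha> i) (\<alpha> i) = - \<alpha> i"
        using that by (intro eq_vecI) (auto simp: reflection_norm_two \<alpha>_dot_\<alpha>)
      then have "act (g \<otimes>\<^bsub>G\<^esub> simple_elt k i) (\<alpha> i) = - \<alpha> i"
        using g that by (simp add: act_mult act_simple_elt fix_g)
      then show ?thesis
        using g that uminus_\<alpha>_notin_cone by (simp add: s_def N.rcos_sum positive_coset)
    qed
    then have "N #>\<^bsub>G\<^esub> g = N"
      using ex_P_mult_s[OF X] by (auto simp del: mult_FactGroup)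
    then show "g \<in> N"
      using g G.rcos_self N.subgroup_axioms by blast
  qed
qed (rule N_subset_kernel)

text \<open>The Weyl group is generated by all reflections in \<open>\<Phi>\<close>, the image of
  the action by the simple ones alone; the second hypothesis closes this gap.\<close>

theorem quotient_by_relator_iso:
  assumes simple: "\<And>i. i < n \<Longrightarrow> \<alpha> i \<in> \<Phi>"
    and \<Phi>: "\<And>a. a \<in> \<Phi> \<Longrightarrow> restrict (reflection a) V \<in>
      generate (BijGroup V) ((\<lambda>i. restrict (reflection (\<alpha> i)) V) ` {..<n})"
  shows "quotient_by G (relator n k {1..k} k (Suc k)) \<cong> weyl_group m \<Phi>"
proof -
  interpret group_hom G "BijGroup V" \<phi>
    by (rule \<phi>_hom)
  let ?S = "(\<lambda>i. restrict (reflection (\<alpha> i)) V) ` {..<n}" and ?R = "{restrict (reflection a) V | a. a \<in> \<Phi>}"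
  have \<phi>_simple: "\<phi> (simple_elt k i) = restrict (reflection (\<alpha> i)) V" if "i < n" for i
    using that by (auto simp: act_simple_elt)
  have S: "?S = \<phi> ` simple_elt k ` {..<n}"
    unfolding image_image by (intro image_cong) (simp_all add: \<phi>_simple)
  have "?S \<subseteq> carrier (BijGroup V)"
    unfolding S by auto
  have "generate (BijGroup V) ?S \<subseteq> generate (BijGroup V) (carrier (BijGroup V) \<inter> ?R)"
    using \<open>?S \<subseteq> carrier (BijGroup V)\<close> simple by (intro H.mono_generate) auto
  moreover have "generate (BijGroup V) (carrier (BijGroup V) \<inter> ?R) \<subseteq> generate (BijGroup V) ?S"
    using \<Phi> by (intro H.generate_subgroup_incl H.generate_is_subgroup[OF \<open>?S \<subseteq> _\<close>]) auto
  ultimately have "carrier (weyl_group m \<Phi>) = generate (BijGroup V) ?S"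
    unfolding weyl_group_def carrier_subgroup_generated by blast
  also have "\<dots> = \<phi> ` carrier G"
    unfolding S using k by (subst generate_img) (auto simp: generate_simple_elt)
  finally have image: "\<phi> ` carrier G = carrier (weyl_group m \<Phi>)" ..
  have "group_hom G (weyl_group m \<Phi>) \<phi>"
    using image homh by (auto simp: group_hom_def group_hom_axioms_def hom_def weyl_group_def
        intro: G.group_axioms H.group_subgroup_generated)
  moreover have "kernel G (weyl_group m \<Phi>) \<phi> = N"
    using kernel_eq by (simp add: kernel_def weyl_group_def)
  ultimately show ?thesis
    using group_hom.FactGroup_iso[OF _ image] by (simp add: quotient_by_def N_def r_def)
qed

end

section \<open>Reflections in a reflection group\<close>

locale reflection_subgroup =
  fixes m :: nat and H :: "(real vec \<Rightarrow> real vec) set"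
  assumes subgroup_H: "subgroup H (BijGroup (carrier_vec m))"
begin

abbreviation e :: "nat \<Rightarrow> real vec" where
  "e \<equiv> unit_vec m"

text \<open>To put a reflection into \<open>H\<close>, it is enough to build its root inside this
  set; norm 2 is what \<open>reflection_add\<close> requires.\<close>

definition roots :: "real vec set" where
  "roots = {a \<in> carrier_vec m. a \<bullet> a = 2 \<and> restrict (reflection a) (carrier_vec m) \<in> H}"

lemma roots_closed: "a \<in> roots \<Longrightarrow> a \<in> carrier_vec m"
  by (simp add: roots_def)

lemma uminus_roots: "a \<in> roots \<Longrightarrow> - a \<in> roots"
  using reflection_uminus[of a m] by (auto simp: roots_def cong: restrict_cong)

lemma uminus_roots_iff: "a \<in> carrier_vec m \<Longrightarrow> - a \<in> roots \<longleftrightarrow> a \<in> roots"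
  using uminus_roots[of a] uminus_roots[of "- a"] by auto

lemma add_roots:
  assumes a: "a \<in> roots" and b: "b \<in> roots" and ab: "a \<bullet> b = - 1"
  shows "a + b \<in> roots"
proof -
  let ?r = "\<lambda>a. restrict (reflection a) (carrier_vec m)"
  have H: "?r a \<in> H" "?r b \<in> H" and V: "a \<in> carrier_vec m" "b \<in> carrier_vec m"
    and norm: "a \<bullet> a = 2" "b \<bullet> b = 2"
    using a b by (simp_all add: roots_def)
  have "b \<bullet> a = - 1"
    using V ab comm_scalar_prod[of a m b] by simp
  then have "(a + b) \<bullet> (a + b) = 2"
    using V norm ab by (simp add: dot_distribs[where m = m])
  moreover have "?r (a + b) = ?r a \<otimes>\<^bsub>BijGroup (carrier_vec m)\<^esub> (?r b \<otimes>\<^bsub>BijGroup (carrier_vec m)\<^esub> ?r a)"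
  proof -
    have "H \<subseteq> Bij (carrier_vec m)"
      using subgroup.subset[OF subgroup_H] by (simp add: BijGroup_def)
    with H have "?r a \<in> Bij (carrier_vec m)" "?r b \<in> Bij (carrier_vec m)"
      by blast+
    then show ?thesis
      using V norm ab by (simp add: BijGroup_def compose_Bij) (auto simp: compose_def reflection_add)
  qed
  ultimately show ?thesis
    using V H by (simp add: roots_def subgroup.m_closed[OF subgroup_H])
qed

lemma diff_roots:
  assumes "a \<in> roots" "b \<in> roots" "a \<bullet> b = 1"
  shows "a - b \<in> roots"
proof -
  have V: "a \<in> carrier_vec m" "b \<in> carrier_vec m"
    using assms by (simp_all add: roots_closed)
  then have "a \<bullet> (- b) = - 1"
    using assms by simp
  then have "a + (- b) \<in> roots"
    using add_roots uminus_roots assms by blast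
  then show ?thesis
    using V by (simp add: minus_add_uminus_vec)
qed

lemma unit_vec_diff_roots:
  assumes "N < m" and step: "\<And>i. i < N \<Longrightarrow> e i - e (Suc i) \<in> roots"
    and "i \<le> N" "j \<le> N" "i \<noteq> j"
  shows "e i - e j \<in> roots"
proof -
  have up: "i < j \<Longrightarrow> j \<le> N \<Longrightarrow> e i - e j \<in> roots" for i j
  proof (induction j)
    case (Suc j)
    show ?case
    proof (cases "i = j")
      case True
      then show ?thesis
        using step Suc by simp
    next
      case False
      then have "e i - e j \<in> roots" "e j - e (Suc j) \<in> roots"
        using Suc step by simp_all
      moreover have "(e i - e j) \<bullet> (e j - e (Suc j)) = - 1"
        using False Suc.prems \<open>N < m\<close> by (simp add: dot_distribs[where m = m])
      ultimately have "(e i - e j) + (e j - e (Suc j)) \<in> roots"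
        by (rule add_roots)
      moreover have "(e i - e j) + (e j - e (Suc j)) = e i - e (Suc j)"
        by (intro eq_vecI) auto
      ultimately show ?thesis
        by simp
    qed
  qed simp
  have "e i - e j = - (e j - e i)"
    by (intro eq_vecI) auto
  then show ?thesis
    using assms(3-5) up[of i j] up[of j i] uminus_roots[of "e j - e i"] by (cases i j rule: linorder_cases) auto
qed

text \<open>Adding the difference \<open>e j - e i\<close> to \<open>e i + e k\<close> exchanges the
  index \<open>i\<close> for \<open>j\<close>, and the two roots have inner product
  \<open>-1\<close>.\<close>

lemma unit_vec_add_roots:
  assumes "N < m" "1 \<le> N" and diff: "\<And>i j. i \<le> N \<Longrightarrow> j \<le> N \<Longrightarrow> i \<noteq> j \<Longrightarrow> e i - e j \<in> roots"
    and zero: "e 0 + e 1 \<in> roots"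
    and "i \<le> N" "j \<le> N" "i \<noteq> j"
  shows "e i + e j \<in> roots"
proof -
  have replace: "e j + e k \<in> roots" if "e i + e k \<in> roots" "i \<le> N" "j \<le> N" "k \<le> N" "i \<noteq> k" "j \<noteq> k" for i j k
  proof (cases "i = j")
    case False
    have "(e i + e k) \<bullet> (e j - e i) = - 1"
      using that False \<open>N < m\<close> by (simp add: dot_distribs[where m = m])
    then have "(e i + e k) + (e j - e i) \<in> roots"
      using add_roots[OF that(1) diff[OF that(3,2)]] False by simp
    moreover have "(e i + e k) + (e j - e i) = e j + e k"
      by (intro eq_vecI) auto
    ultimately show ?thesis
      by simp
  qed (use that in simp)
  have comm: "e i + e j = e j + e i" for i j
    by (intro eq_vecI) auto
  \<comment> \<open>The index pairs passed are {0,1}, {1,i}, {i,j}. For \<open>i = 1\<close> this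
    breaks down, and the roles of \<open>i\<close> and \<open>j\<close> are swapped instead.\<close>
  have *: "e i + e j \<in> roots" if "i \<le> N" "j \<le> N" "i \<noteq> j" "i \<noteq> 1" for i j
  proof -
    have "e 1 + e i \<in> roots"
      using replace[of 0 1 i] zero that \<open>1 \<le> N\<close> comm[of i 1] by simp
    then show ?thesis
      using replace[of 1 i j] that \<open>1 \<le> N\<close> comm[of j i] by simp
  qed
  show ?thesis
    using assms(5-7) *[of i j] *[of j i] comm[of i j] by (cases "i = 1") auto
qed

lemma signed_pair_roots:
  assumes "a \<in> {1, - 1}" "b \<in> {1, - 1}" and "e i + e j \<in> roots" "e i - e j \<in> roots"
  shows "a \<cdot>\<^sub>v e i + b \<cdot>\<^sub>v e j \<in> roots"
proof -
  have "1 \<cdot>\<^sub>v e i + 1 \<cdot>\<^sub>v e j = e i + e j" "1 \<cdot>\<^sub>v e i + (- 1) \<cdot>\<^sub>v e j = e i - e j"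
    "(- 1) \<cdot>\<^sub>v e i + 1 \<cdot>\<^sub>v e j = - (e i - e j)" "(- 1) \<cdot>\<^sub>v e i + (- 1) \<cdot>\<^sub>v e j = - (e i + e j)"
    by (intro eq_vecI; simp)+
  then show ?thesis
    using assms uminus_roots by auto
qed

end

text \<open>Quantifying over all \<open>H\<close> separates the combinatorics of
  \<open>\<Phi>\<close> from the group: each type has only to derive its roots by the closure rules
  of \<open>roots\<close>. The \<open>H\<close> used is generated by the simple reflections.\<close>

lemma quotient_by_relator_iso_weyl_group:
  assumes rep: "progenitor_representation m n k f \<delta> d \<rho>"
    and simple_roots: "\<And>i. i < n \<Longrightarrow> progenitor_representation.\<alpha> m k f \<delta> i \<in> \<Phi>"
    and \<Phi>: "\<And>H a. reflection_subgroup m H \<Longrightarrow>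
      (\<And>i. i < n \<Longrightarrow> progenitor_representation.\<alpha> m k f \<delta> i \<in> reflection_subgroup.roots m H) \<Longrightarrow>
      a \<in> \<Phi> \<Longrightarrow> a \<in> reflection_subgroup.roots m H"
  shows "quotient_by (progenitor n k) (relator n k {1..k} k (Suc k)) \<cong> weyl_group m \<Phi>"
proof -
  interpret progenitor_representation m n k f \<delta> d \<rho>
    by (rule rep)
  interpret group_hom G "BijGroup V" \<phi>
    by (rule \<phi>_hom)
  let ?S = "(\<lambda>i. restrict (reflection (\<alpha> i)) V) ` {..<n}"
  have "?S \<subseteq> carrier (BijGroup V)"
  proof
    fix x assume "x \<in> ?S"
    then obtain i where i: "i < n" "x = restrict (reflection (\<alpha> i)) V"
      by blast
    then have "x = \<phi> (simple_elt k i)"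
      by (auto simp: act_simple_elt)
    with i show "x \<in> carrier (BijGroup V)"
      using hom_closed[of "simple_elt k i"] by simp
  qed
  then interpret reflection_subgroup m "generate (BijGroup V) ?S"
    by (intro reflection_subgroup.intro H.generate_is_subgroup)
  have "\<alpha> i \<in> roots" if "i < n" for i
    using that by (auto simp: roots_def \<alpha>_dot_\<alpha> intro: generate.incl)
  then have "a \<in> roots" if "a \<in> \<Phi>" for a
    using that \<Phi>[OF reflection_subgroup_axioms] by blast
  then show ?thesis
    using simple_roots by (intro quotient_by_relator_iso) (auto simp: roots_def)
qed

section \<open>Types A and D\<close>

text \<open>The extra basis vector \<open>e 0\<close> serves as \<open>\<delta>\<close>, and
  \<open>t\<^sub>i\<close> becomes the transposition of coordinates 0 and \<open>i\<close>.\<close>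

theorem quotient_A:
  assumes "2 \<le> n"
  shows "quotient_by (progenitor n 1) (relator n 1 {1} 1 2) \<cong> weyl_group (n + 1) (roots_A n)"
proof -
  let ?e = "unit_vec (n + 1) :: nat \<Rightarrow> real vec"
  define \<rho> where "\<rho> = vec (n + 1) (\<lambda>i. - real i)"
  have rep: "progenitor_representation (n + 1) n 1 ?e (?e 0) 0 \<rho>"
    using assms by unfold_locales (auto simp: \<rho>_def)
  interpret progenitor_representation "n + 1" n 1 ?e "?e 0" 0 \<rho>
    by (rule rep)
  have \<alpha>: "\<alpha> i = ?e i - ?e (Suc i)" for i
    unfolding \<alpha>_def \<beta>_def by (intro eq_vecI) auto
  have "quotient_by (progenitor n 1) (relator n 1 {1..1} 1 (Suc 1)) \<cong> weyl_group (n + 1) (roots_A n)"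
  proof (rule quotient_by_relator_iso_weyl_group[OF rep])
    fix i assume "i < n"
    then show "\<alpha> i \<in> roots_A n"
      unfolding \<alpha> roots_A_def mem_Collect_eq by (intro exI[of _ i] exI[of _ "Suc i"]) simp
  next
    fix H a
    assume "reflection_subgroup (n + 1) H"
      and simple: "\<And>i. i < n \<Longrightarrow> \<alpha> i \<in> reflection_subgroup.roots (n + 1) H" and a: "a \<in> roots_A n"
    then interpret reflection_subgroup "n + 1" H
      by simp
    obtain i j where "a = ?e i - ?e j" "i < n + 1" "j < n + 1" "i \<noteq> j"
      using a by (auto simp: roots_A_def)
    then show "a \<in> roots"
      using unit_vec_diff_roots[of n i j] simple[unfolded \<alpha>] by simp
  qed
  then show ?thesis
    by (simp add: numeral_2_eq_2)
qed

text \<open>With \<open>\<delta> = 0\<close>, the root of a pair is minus the sum of its two basis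
  vectors, so the generator swaps two coordinates and negates both.\<close>

theorem quotient_D:
  assumes "4 \<le> n"
  shows "quotient_by (progenitor n 2) (relator n 2 {1, 2} 2 3) \<cong> weyl_group n (roots_D n)"
proof -
  let ?e = "unit_vec n :: nat \<Rightarrow> real vec"
  define f where "f i = ?e (i - 1)" for i
  \<comment> \<open>Decreasing entries serve the differences; negative entries serve
    \<open>\<alpha> 0\<close>, the negative of a sum.\<close>
  define \<rho> where "\<rho> = vec n (\<lambda>i. - 1 - real i)"
  have two: "{Suc 0..2} = {1, 2}"
    by auto
  have rep: "progenitor_representation n n 2 f (0\<^sub>v n) 0 \<rho>"
    using assms by unfold_locales (auto simp: \<rho>_def f_def two)
  interpret progenitor_representation n n 2 f "0\<^sub>v n" 0 \<rho>
    by (rule rep)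
  have \<alpha>_0: "\<alpha> 0 = - (?e 0 + ?e 1)"
    unfolding \<alpha>_def \<beta>_def using assms by (intro eq_vecI) (auto simp: f_def two)
  have \<alpha>_Suc: "\<alpha> (Suc i) = ?e i - ?e (Suc i)" for i
    unfolding \<alpha>_def by (simp add: f_def)
  have "quotient_by (progenitor n 2) (relator n 2 {1..2} 2 (Suc 2)) \<cong> weyl_group n (roots_D n)"
  proof (rule quotient_by_relator_iso_weyl_group[OF rep])
    fix i assume i: "i < n"
    show "\<alpha> i \<in> roots_D n"
    proof (cases i)
      case 0
      have "\<alpha> i = (- 1) \<cdot>\<^sub>v ?e 0 + (- 1) \<cdot>\<^sub>v ?e 1"
        unfolding 0 \<alpha>_0 by (intro eq_vecI) auto
      then show ?thesis
        unfolding roots_D_def mem_Collect_eq using assms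
        by (intro exI[of _ "- 1"] exI[of _ "0 :: nat"] exI[of _ "1 :: nat"]) simp
    next
      case (Suc j)
      have "\<alpha> i = 1 \<cdot>\<^sub>v ?e j + (- 1) \<cdot>\<^sub>v ?e (Suc j)"
        unfolding Suc \<alpha>_Suc by (intro eq_vecI) auto
      then show ?thesis
        unfolding roots_D_def mem_Collect_eq using i Suc
        by (intro exI[of _ "1 :: real"] exI[of _ "- 1 :: real"] exI[of _ j] exI[of _ "Suc j"]) simp
    qed
  next
    fix H a
    assume "reflection_subgroup n H"
      and simple: "\<And>i. i < n \<Longrightarrow> \<alpha> i \<in> reflection_subgroup.roots n H" and a: "a \<in> roots_D n"
    then interpret reflection_subgroup n H
      by simp
    have diff: "e i - e j \<in> roots" if "i \<le> n - 1" "j \<le> n - 1" "i \<noteq> j" for i j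
      using unit_vec_diff_roots[of "n - 1" i j] that simple[of "Suc _"] assms by (simp add: \<alpha>_Suc)
    have "e 0 + e 1 \<in> roots"
      using simple[of 0] assms by (simp add: \<alpha>_0 uminus_roots_iff)
    then have add: "e i + e j \<in> roots" if "i \<le> n - 1" "j \<le> n - 1" "i \<noteq> j" for i j
      using unit_vec_add_roots[of "n - 1" i j] that diff assms by simp
    obtain c d i j where "a = c \<cdot>\<^sub>v e i + d \<cdot>\<^sub>v e j" "c \<in> {1, - 1}" "d \<in> {1, - 1}" "i < j" "j < n"
      using a unfolding roots_D_def by blast
    then show "a \<in> roots"
      using signed_pair_roots add[of i j] diff[of i j] by simp
  qed
  then show ?thesis
    by (simp add: two numeral_3_eq_3)
qed

section \<open>Type E\<close>

lemma sum_lessThan_8: "sum g {0..<8 :: nat} = g 0 + g 1 + g 2 + g 3 + g 4 + g 5 + g 6 + (g 7 :: real)"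
  by (simp add: eval_nat_numeral)

definition half :: "nat set \<Rightarrow> real vec" where
  "half M = vec 8 (\<lambda>i. if i \<in> M then - 1/2 else 1/2)"

lemma half_closed [simp]: "half M \<in> carrier_vec 8"
  by (simp add: half_def)

lemma half_index [simp]: "i < 8 \<Longrightarrow> half M $ i = (if i \<in> M then - 1/2 else 1/2)"
  by (simp add: half_def)

lemma half_dim [simp]: "dim_vec (half M) = 8"
  by (simp add: half_def)

lemma half_in_roots_E8:
  assumes "M \<subseteq> {..<8}" "even (card M)"
  shows "half M \<in> roots_E8"
proof -
  have "{i. i < 8 \<and> half M $ i = - 1/2} = M"
    using assms by (auto split: if_splits)
  then show ?thesis
    using assms by (auto simp: roots_E8_def)
qed

lemma roots_E8_cases:
  assumes "v \<in> roots_E8"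
  obtains (pair) a b i j where "v = a \<cdot>\<^sub>v unit_vec 8 i + b \<cdot>\<^sub>v unit_vec 8 j"
      "a \<in> {1, - 1}" "b \<in> {1, - 1}" "i < j" "j < 8"
  | (half) M where "M \<subseteq> {..<8}" "even (card M)" "v = half M"
proof (cases "v \<in> roots_D 8")
  case True
  then show ?thesis
    unfolding roots_D_def using pair by blast
next
  case False
  define M where "M = {i. i < 8 \<and> v $ i = - 1/2}"
  have v: "v \<in> carrier_vec 8" "\<And>i. i < 8 \<Longrightarrow> v $ i \<in> {1/2, - 1/2}" "even (card M)"
    using False assms by (auto simp: roots_E8_def M_def)
  have "v = half M"
    using v(1,2) by (intro eq_vecI) (auto simp: M_def)
  moreover have "M \<subseteq> {..<8}"
    by (auto simp: M_def)
  ultimately show ?thesis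
    using half v(3) by blast
qed

lemma uminus_half:
  "M \<subseteq> {..<8} \<Longrightarrow> - half M = half ({..<8} - M)"
  by (intro eq_vecI) auto

section \<open>Reaching all roots of type E from the simple ones\<close>

context reflection_subgroup
begin

text \<open>Exactly one of \<open>e i + e j\<close>, \<open>e i - e j\<close> has inner product 1 or
  -1 with \<open>half M\<close>; subtracting or adding it negates both entries.\<close>

lemma flip_half:
  assumes m: "m = 8" and "half M \<in> roots" and i: "i < 8" and j: "j < 8" and "i \<noteq> j"
    and "e i + e j \<in> roots" "e i - e j \<in> roots"
  shows "half (sym_diff M {i, j}) \<in> roots"
proof -
  define h :: "nat \<Rightarrow> real" where "h l = (if l \<in> M then - 1/2 else 1/2)" for l
  have dot: "half M \<bullet> (e i + e j) = h i + h j" "half M \<bullet> (e i - e j) = h i - h j"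
    using i j by (simp_all add: m h_def dot_distribs[where m = 8])
  have vec_eq: "x = half (sym_diff M {i, j})"
    if "dim_vec x = 8" "x $ i = - half M $ i" "x $ j = - half M $ j"
      "\<And>l. l < 8 \<Longrightarrow> l \<noteq> i \<Longrightarrow> l \<noteq> j \<Longrightarrow> x $ l = half M $ l" for x
  proof (rule eq_vecI)
    fix l assume "l < dim_vec (half (sym_diff M {i, j}))"
    then show "x $ l = half (sym_diff M {i, j}) $ l"
      using that i j \<open>i \<noteq> j\<close> by (cases "l = i"; cases "l = j") simp_all
  qed (use that in simp)
  consider "i \<in> M" "j \<in> M" | "i \<in> M" "j \<notin> M" | "i \<notin> M" "j \<in> M" | "i \<notin> M" "j \<notin> M"
    by blast
  then show ?thesis
  proof cases
    case 1
    then have "half M + (e i + e j) \<in> roots"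
      by (intro add_roots[OF assms(2,6)]) (simp add: dot h_def)
    moreover have "half M + (e i + e j) = half (sym_diff M {i, j})"
      using 1 i j \<open>i \<noteq> j\<close> by (intro vec_eq) (simp_all add: m)
    ultimately show ?thesis
      by simp
  next
    case 2
    then have "half M + (e i - e j) \<in> roots"
      by (intro add_roots[OF assms(2,7)]) (simp add: dot h_def)
    moreover have "half M + (e i - e j) = half (sym_diff M {i, j})"
      using 2 i j \<open>i \<noteq> j\<close> by (intro vec_eq) (simp_all add: m)
    ultimately show ?thesis
      by simp
  next
    case 3
    then have "half M - (e i - e j) \<in> roots"
      by (intro diff_roots[OF assms(2,7)]) (simp add: dot h_def)
    moreover have "half M - (e i - e j) = half (sym_diff M {i, j})"
      using 3 i j \<open>i \<noteq> j\<close> by (intro vec_eq) (simp_all add: m)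
    ultimately show ?thesis
      by simp
  next
    case 4
    then have "half M - (e i + e j) \<in> roots"
      by (intro diff_roots[OF assms(2,6)]) (simp add: dot h_def)
    moreover have "half M - (e i + e j) = half (sym_diff M {i, j})"
      using 4 i j \<open>i \<noteq> j\<close> by (intro vec_eq) (simp_all add: m)
    ultimately show ?thesis
      by simp
  qed
qed

lemma flip_even_half:
  assumes m: "m = 8" and M: "half M \<in> roots" and N: "N < 8"
    and pairs: "\<And>i j. i \<le> N \<Longrightarrow> j \<le> N \<Longrightarrow> i \<noteq> j \<Longrightarrow> e i + e j \<in> roots \<and> e i - e j \<in> roots"
  shows "D \<subseteq> {..N} \<Longrightarrow> even (card D) \<Longrightarrow> half (sym_diff M D) \<in> roots"
proof (induction "card D" arbitrary: D rule: less_induct)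
  case less
  show ?case
  proof (cases "D = {}")
    case True
    then show ?thesis
      using M by simp
  next
    case False
    have fin: "finite D"
      using less.prems finite_subset by blast
    obtain i where i: "i \<in> D"
      using False by blast
    have "D - {i} \<noteq> {}"
    proof
      assume "D - {i} = {}"
      then have "D = {i}"
        using i by blast
      then show False
        using less.prems by simp
    qed
    then obtain j where j: "j \<in> D" "i \<noteq> j"
      by blast
    define D' where "D' = D - {i, j}"
    have "D = insert i (insert j D')" "i \<notin> insert j D'" "j \<notin> D'" "finite D'"
      using i j fin by (auto simp: D'_def)
    then have "card D = Suc (Suc (card D'))"
      by simp
    then have "card D' < card D" "even (card D')" "D' \<subseteq> {..N}"
      using less.prems by (auto simp: D'_def)
    then have "half (sym_diff M D') \<in> roots"
      using less.hyps by blast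
    then have "half (sym_diff (sym_diff M D') {i, j}) \<in> roots"
      using i j less.prems N pairs[of i j] by (intro flip_half[OF m]) auto
    moreover have "sym_diff (sym_diff M D') {i, j} = sym_diff M D"
      using i j by (auto simp: D'_def)
    ultimately show ?thesis
      by simp
  qed
qed

text \<open>These are the even sign vectors with entry 7 positive and the entries between
  \<open>N\<close> and 7 negative. Each differs from \<open>half {1..6}\<close> in an even number of
  places up to \<open>N\<close>, so pair flips reach it.\<close>

lemma half_roots:
  assumes m: "m = 8" and zero: "half {1..6} \<in> roots" and N: "4 \<le> N" "N < 7"
    and pairs: "\<And>i j. i \<le> N \<Longrightarrow> j \<le> N \<Longrightarrow> i \<noteq> j \<Longrightarrow> e i + e j \<in> roots \<and> e i - e j \<in> roots"
    and M: "M \<subseteq> {..<7}" "{N<..<7} \<subseteq> M" "even (card M)"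
  shows "half M \<in> roots"
proof -
  define D where "D = sym_diff {1..6} M"
  have fin: "finite M"
    using M finite_subset by blast
  have "card ({1..6} - M) + card ({1..6} \<inter> M) = 6" "card (M - {1..6}) + card ({1..6} \<inter> M) = card M"
    using fin card_Diff_subset_Int[of "{1..6}" M] card_Diff_subset_Int[of M "{1..6}"]
      card_mono[of "{1..6 :: nat}" "{1..6} \<inter> M"] card_mono[of M "{1..6} \<inter> M"]
    by (auto simp: Int_commute)
  moreover have "card D = card ({1..6} - M) + card (M - {1..6})"
    unfolding D_def using fin by (intro card_Un_disjoint) auto
  ultimately have "card D + 2 * card ({1..6} \<inter> M) = 6 + card M"
    by simp
  then have "even (card D + 2 * card ({1..6} \<inter> M))"
    using M by simp
  then have "even (card D)"
    by simp
  moreover have "D \<subseteq> {..N}"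
  proof
    fix l assume "l \<in> D"
    show "l \<in> {..N}"
    proof (rule ccontr)
      assume l: "l \<notin> {..N}"
      have "l < 7"
        using \<open>l \<in> D\<close> M(1) by (auto simp: D_def)
      then have "l \<in> M" "l \<in> {1..6}"
        using l M(2) N by auto
      then show False
        using \<open>l \<in> D\<close> by (simp add: D_def)
    qed
  qed
  ultimately have "half (sym_diff {1..6} D) \<in> roots"
    using flip_even_half[OF m zero, of N D] N pairs by simp
  moreover have "sym_diff {1..6} D = M"
    by (auto simp: D_def)
  ultimately show ?thesis
    by simp
qed

text \<open>Entries between \<open>N\<close> and 7 are tied to minus entry 7. Sign vectors come from
  \<open>half_roots\<close>, up to negation; roots \<open>e i\<close> plus or minus
  \<open>e j\<close> with \<open>j \<le> N\<close> are given, and those involving \<open>e 7\<close>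
  arise as sums of two sign vectors.\<close>

lemma roots_E_subset_roots:
  assumes m: "m = 8" and zero: "half {1..6} \<in> roots" and N: "4 \<le> N" "N < 7"
    and pairs: "\<And>i j. i \<le> N \<Longrightarrow> j \<le> N \<Longrightarrow> i \<noteq> j \<Longrightarrow> e i + e j \<in> roots \<and> e i - e j \<in> roots"
    and v: "v \<in> roots_E8" "\<And>l. N < l \<Longrightarrow> l < 7 \<Longrightarrow> v $ l = - v $ 7"
  shows "v \<in> roots"
proof -
  have half_roots: "half M \<in> roots" if "M \<subseteq> {..<7}" "{N<..<7} \<subseteq> M" "even (card M)" for M
    by (rule half_roots[OF m zero N]) (use pairs that in auto)
  have minus: "e 7 - e i \<in> roots" if i: "i < 7" "{N<..<7} \<subseteq> {i}" for i
  proof -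
    \<comment> \<open>A spare index that is never tied; it makes both minus sets even. The two sign
      vectors agree only at \<open>i\<close> and 7, which gives inner product 2/4 - 6/4 =
      -1.\<close>
    define k :: nat where "k = (if i = 0 then 1 else 0)"
    have k: "k \<noteq> i" "k \<le> 1"
      by (auto simp: k_def)
    have "half {i, k} \<in> roots"
      using i k by (intro half_roots) auto
    moreover have "half ({..<7} - {k}) \<in> roots"
      using i k N by (intro half_roots) auto
    moreover have "half {i, k} \<bullet> half ({..<7} - {k}) = - 1"
      using i by (auto simp: scalar_prod_def sum_lessThan_8 k_def less_Suc_eq numeral_eq_Suc)
    ultimately have "half {i, k} + half ({..<7} - {k}) \<in> roots"
      by (rule add_roots)
    moreover have "half {i, k} + half ({..<7} - {k}) = e 7 - e i"
      using i k by (intro eq_vecI) (auto simp: m)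
    ultimately show ?thesis
      by simp
  qed
  \<comment> \<open>The empty minus set is admissible only if no entry is tied, that is, in type
    E8.\<close>
  have plus: "e 7 + e i \<in> roots" if i: "i < 7" and "N = 6" for i
  proof -
    have empty: "{N<..<7} = {}"
      using \<open>N = 6\<close> by auto
    have "half {} \<in> roots"
      using empty by (intro half_roots) auto
    moreover have "half ({..<7} - {i}) \<in> roots"
      using i empty by (intro half_roots) auto
    moreover have "half {} \<bullet> half ({..<7} - {i}) = - 1"
      using i by (auto simp: scalar_prod_def sum_lessThan_8 less_Suc_eq numeral_eq_Suc)
    ultimately have "half {} + half ({..<7} - {i}) \<in> roots"
      by (rule add_roots)
    moreover have "half {} + half ({..<7} - {i}) = e 7 + e i"
      using i by (intro eq_vecI) (auto simp: m)
    ultimately show ?thesis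
      by simp
  qed
  from v(1) show ?thesis
  proof (cases rule: roots_E8_cases)
    case (pair a b i j)
    then have index: "v $ l = (if l = i then a else if l = j then b else 0)" if "l < 8" for l
      using that by auto
    have v': "v = a \<cdot>\<^sub>v e i + b \<cdot>\<^sub>v e j"
      using pair m by simp
    consider "j \<le> N" | "N < j" "j < 7" | "j = 7"
      using pair by linarith
    then show ?thesis
    proof cases
      case 1
      then show ?thesis
        unfolding v' using pair pairs[of i j] by (intro signed_pair_roots) auto
    next
      case 2
      \<comment> \<open>Entry \<open>j\<close> is tied to entry 7, which vanishes here.\<close>
      then have "b = 0"
        using v(2)[of j] index[of j] index[of 7] pair by simp
      then show ?thesis
        using pair by auto
    next
      case 3
      \<comment> \<open>Entry 7 is \<open>b\<close> and nonzero, so a tied entry is nonzero too and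
        can only be entry \<open>i\<close>.\<close>
      have sub: "{N<..<7} \<subseteq> {i}"
      proof
        fix l assume "l \<in> {N<..<7}"
        then have "v $ l = - b"
          using v(2)[of l] index[of 7] 3 pair by simp
        then show "l \<in> {i}"
          using index[of l] 3 pair \<open>l \<in> _\<close> by (auto split: if_splits)
      qed
      have comm: "e i + e 7 = e 7 + e i" "- (e 7 - e i) = e i - e 7"
        by (intro eq_vecI; simp)+
      have diff: "e i - e 7 \<in> roots"
        using uminus_roots[OF minus[OF _ sub]] 3 pair comm by simp
      show ?thesis
      proof (cases "N = 6")
        case True
        then show ?thesis
          unfolding v' 3 using pair diff plus[of i] 3 comm by (intro signed_pair_roots) auto
      next
        case False
        \<comment> \<open>With entry 6 tied, only the multiples of \<open>e 6 - e 7\<close> by 1 and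
          -1 remain.\<close>
        then have "6 \<in> {N<..<7}"
          using N by simp
        then have "i = 6"
          using subsetD[OF sub] by blast
        then have "a = - b"
          using v(2)[of 6] index[of 6] index[of 7] 3 pair False N by simp
        then have "v = a \<cdot>\<^sub>v (e i - e 7)"
          unfolding v' 3 by (intro eq_vecI) (auto simp: m algebra_simps)
        moreover have "1 \<cdot>\<^sub>v (e i - e 7) = e i - e 7" "(- 1) \<cdot>\<^sub>v (e i - e 7) = - (e i - e 7)"
          by (intro eq_vecI; simp)+
        ultimately show ?thesis
          using diff uminus_roots pair(2) by auto
      qed
    qed
  next
    case (half M)
    have index: "v $ l = (if l \<in> M then - 1/2 else 1/2)" if "l < 8" for l
      using that half by simp
    show ?thesis
    proof (cases "7 \<in> M")
      case False
      have "M \<subseteq> {..<7}"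
        using half(1) False by (auto simp: less_Suc_eq numeral_eq_Suc)
      moreover have "{N<..<7} \<subseteq> M"
        using v(2) index index[of 7] False by (force split: if_splits)
      ultimately show ?thesis
        using half half_roots by simp
    next
      case True
      \<comment> \<open>Negation complements the minus set and makes entry 7 positive.\<close>
      have "{..<8} - M \<subseteq> {..<7}"
        using True by (auto simp: less_Suc_eq numeral_eq_Suc)
      moreover have "{N<..<7} \<subseteq> {..<8} - M"
        using v(2) index index[of 7] True by (force split: if_splits)
      moreover have "even (card ({..<8} - M))"
        using half finite_subset[OF half(1)] card_mono[OF _ half(1)] by (simp add: card_Diff_subset)
      ultimately have "half ({..<8} - M) \<in> roots"
        by (rule half_roots)
      then show ?thesis
        using half uminus_half[OF half(1)] uminus_roots_iff[of v] roots_closed[of v] m by simp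
    qed
  qed
qed

end

text \<open>A uniform description with free entries up to \<open>n - 2\<close>: the tied ones are 5
  and 6 for E6, 6 for E7, none for E8.\<close>

lemma roots_E_iff:
  assumes "n \<in> {6, 7, 8}"
  shows "v \<in> roots_E n \<longleftrightarrow> v \<in> roots_E8 \<and> (\<forall>l. n - 2 < l \<and> l < 7 \<longrightarrow> v $ l = - v $ 7)"
proof -
  have 5: "(\<forall>l. 4 < l \<and> l < (7::nat) \<longrightarrow> P l) \<longleftrightarrow> P 5 \<and> P 6" for P
    by (auto simp: less_Suc_eq numeral_eq_Suc)
  have 6: "(\<forall>l. 5 < l \<and> l < (7::nat) \<longrightarrow> P l) \<longleftrightarrow> P 6" for P
    by (auto simp: less_Suc_eq numeral_eq_Suc)
  have 7: "(\<forall>l. 6 < l \<and> l < (7::nat) \<longrightarrow> P l)" for P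
    by auto
  show ?thesis
    using assms by (auto simp: roots_E_def roots_E7_def roots_E6_def 5 6 7)
qed

theorem quotient_E:
  assumes n: "n \<in> {6, 7, 8}"
  shows "quotient_by (progenitor n 3) (relator n 3 {1, 2, 3} 3 4) \<cong> weyl_group 8 (roots_E n)"
proof -
  let ?e = "unit_vec 8 :: nat \<Rightarrow> real vec"
  \<comment> \<open>Up to sign and order, the \<open>f i\<close> are the images of the standard basis under the reflection in
    the all-ones vector; they are chosen so that the roots \<open>\<alpha> i\<close> become Bourbaki's simple roots.\<close>
  define c :: "real vec" where "c = vec 8 (\<lambda>_. 1/4)"
  define f where "f i = (if i = 1 then ?e 7 - c else c - ?e (i - 2))" for i
  \<comment> \<open>Half the sum of the positive roots of E8 in Bourbaki's coordinates; it has inner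
    product 1 with each simple root.\<close>
  define \<rho> :: "real vec" where "\<rho> = vec 8 (\<lambda>i. if i = 7 then 23 else real i)"
  have n': "6 \<le> n" "n \<le> 8"
    using n by auto
  have c_closed [simp]: "c \<in> carrier_vec 8" "dim_vec c = 8"
    by (simp_all add: c_def)
  have c_index: "c $ i = 1/4" if "i < 8" for i
    using that by (simp add: c_def)
  have c_dot: "c \<bullet> c = 1/2" "c \<bullet> \<rho> = 11" "\<And>i. i < 8 \<Longrightarrow> ?e i \<bullet> c = 1/4" "\<And>i. i < 8 \<Longrightarrow> c \<bullet> ?e i = 1/4"
    by (simp_all add: c_def \<rho>_def scalar_prod_def[of _ "vec 8 _"] sum_lessThan_8)
  have \<rho>_dot: "?e i \<bullet> \<rho> = \<rho> $ i" if "i < 8" for i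
    using that by (simp add: \<rho>_def)
  have three: "{Suc 0..3} = {1, 2, 3}"
    by auto
  \<comment> \<open>The vector \<open>c + e 7\<close> is \<open>f 1 + f 2 + f 3\<close> plus the
    root \<open>e 0 + e 1\<close> intended for \<open>\<alpha> 0\<close>.\<close>
  have rep: "progenitor_representation 8 n 3 f (c + ?e 7) (1/2) \<rho>"
  proof
    show "f i \<in> carrier_vec 8" if "i \<in> {1..n}" for i
      by (simp add: f_def)
    show "f i \<bullet> f j = of_bool (i = j)" if "i \<in> {1..n}" "j \<in> {1..n}" for i j
      using that n' by (auto simp: f_def dot_distribs[where m = 8] c_dot c_index; arith)
    show "f i \<bullet> (c + ?e 7) = 1/2" if "i \<in> {1..n}" for i
      using that n' by (auto simp: f_def dot_distribs[where m = 8] c_dot c_index)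
    show "(c + ?e 7) \<bullet> (c + ?e 7) = 2 + 2 * real 3 * (1/2) - real 3"
      by (simp add: dot_distribs[where m = 8] c_dot c_index)
    have "\<rho> \<in> carrier_vec 8"
      by (simp add: \<rho>_def)
    then have f_\<rho>: "f i \<bullet> \<rho> = 13 - real i" if "i \<in> {1..n}" for i
      using that n' by (auto simp: f_def dot_distribs[where m = 8] c_dot \<rho>_dot) (auto simp: \<rho>_def)
    show "f (Suc i) \<bullet> \<rho> < f i \<bullet> \<rho>" if "i \<in> {1..<n}" for i
      using that f_\<rho>[of i] f_\<rho>[of "Suc i"] by simp
    have "(c + ?e 7) \<bullet> \<rho> = 34"
      using \<open>\<rho> \<in> _\<close> by (simp add: dot_distribs[where m = 8] c_dot \<rho>_dot) (simp add: \<rho>_def)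
    then show "(\<Sum>i = 1..3. f i \<bullet> \<rho>) < (c + ?e 7) \<bullet> \<rho>"
      using n' by (simp add: three f_\<rho>)
  qed (use n' in \<open>auto simp: \<rho>_def\<close>)
  interpret progenitor_representation 8 n 3 f "c + ?e 7" "1/2" \<rho>
    by (rule rep)
  have \<alpha>_0: "\<alpha> 0 = ?e 0 + ?e 1"
    unfolding \<alpha>_def \<beta>_def by (intro eq_vecI) (auto simp: f_def c_def three)
  have \<alpha>_1: "\<alpha> 1 = half {1..6}"
    unfolding \<alpha>_def by (intro eq_vecI) (auto simp: f_def c_def less_Suc_eq numeral_eq_Suc)
  have \<alpha>_Suc: "\<alpha> (Suc (Suc i)) = ?e (Suc i) - ?e i" for i
    unfolding \<alpha>_def by (intro eq_vecI) (auto simp: f_def c_def)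
  have "quotient_by (progenitor n 3) (relator n 3 {1..3} 3 (Suc 3)) \<cong> weyl_group 8 (roots_E n)"
  proof (rule quotient_by_relator_iso_weyl_group[OF rep])
    fix i assume i: "i < n"
    have pair: "a \<cdot>\<^sub>v ?e i + b \<cdot>\<^sub>v ?e j \<in> roots_E n"
      if "a \<in> {1, - 1}" "b \<in> {1, - 1}" "i < j" "j \<le> n - 2" for a b i j
    proof -
      have "a \<cdot>\<^sub>v ?e i + b \<cdot>\<^sub>v ?e j \<in> roots_D 8"
        unfolding roots_D_def mem_Collect_eq using that n'
        by (intro exI[of _ a] exI[of _ b] exI[of _ i] exI[of _ j]) simp
      then show ?thesis
        using that n' by (simp add: roots_E_iff[OF n] roots_E8_def)
    qed
    consider "i = 0" | "i = 1" | j where "i = Suc (Suc j)"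
      by (metis One_nat_def not0_implies_Suc)
    then show "\<alpha> i \<in> roots_E n"
    proof cases
      case 1
      have "?e 0 + ?e 1 = 1 \<cdot>\<^sub>v ?e 0 + 1 \<cdot>\<^sub>v ?e 1"
        by simp
      then show ?thesis
        unfolding 1 \<alpha>_0 using pair[of 1 1 0 1] n' by simp
    next
      case 2
      have "half {1..6} \<in> roots_E8"
        by (rule half_in_roots_E8) auto
      then show ?thesis
        unfolding 2 \<alpha>_1 using n' by (simp add: roots_E_iff[OF n])
    next
      case (3 j)
      have "?e (Suc j) - ?e j = (- 1) \<cdot>\<^sub>v ?e j + 1 \<cdot>\<^sub>v ?e (Suc j)"
        by (intro eq_vecI) auto
      then show ?thesis
        unfolding 3 \<alpha>_Suc using pair[of "- 1" 1 j "Suc j"] i 3 by simp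
    qed
  next
    fix H a
    assume "reflection_subgroup 8 H"
      and simple: "\<And>i. i < n \<Longrightarrow> \<alpha> i \<in> reflection_subgroup.roots 8 H" and a: "a \<in> roots_E n"
    then interpret reflection_subgroup 8 H
      by simp
    have "e i - e (Suc i) \<in> roots" if "i < n - 2" for i
    proof -
      have "- (e (Suc i) - e i) = e i - e (Suc i)"
        by (intro eq_vecI) auto
      then show ?thesis
        using that uminus_roots[OF simple[of "Suc (Suc i)", unfolded \<alpha>_Suc]] by simp
    qed
    then have diff: "e i - e j \<in> roots" if "i \<le> n - 2" "j \<le> n - 2" "i \<noteq> j" for i j
      using unit_vec_diff_roots[of "n - 2" i j] that n' by simp
    have "e 0 + e 1 \<in> roots"
      using simple[of 0] n' by (simp add: \<alpha>_0)
    then have add: "e i + e j \<in> roots" if "i \<le> n - 2" "j \<le> n - 2" "i \<noteq> j" for i j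
      using unit_vec_add_roots[of "n - 2" i j] that diff n' by simp
    show "a \<in> roots"
    proof (rule roots_E_subset_roots[of "n - 2"])
      show "half {1..6} \<in> roots"
        using simple[of 1] n' unfolding \<alpha>_1 by simp
    qed (use a n' add diff in \<open>auto simp: roots_E_iff[OF n]\<close>)
  qed
  moreover have "{1..3} = {1, 2, 3 :: nat}"
    by auto
  ultimately show ?thesis
    by simp
qed

theorem theorem5:
  fixes n :: nat
  shows "(n \<ge> 2 \<longrightarrow>
            quotient_by (progenitor n 1) (relator n 1 {1} 1 2) \<cong> weyl_group (n + 1) (roots_A n)) \<and>
         (n \<ge> 4 \<longrightarrow>
            quotient_by (progenitor n 2) (relator n 2 {1, 2} 2 3) \<cong> weyl_group n (roots_D n)) \<and>
         (n \<in> {6, 7, 8} \<longrightarrow>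
            quotient_by (progenitor n 3) (relator n 3 {1, 2, 3} 3 4) \<cong> weyl_group 8 (roots_E n))"
  using quotient_A quotient_D quotient_E by blast

end
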